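(* Let $P_0$ be a Borel probability measure on $\mathbb R^d$, and let $\mathcal C$, $\mathfrak M$, $\mathcal G$ be the associated classes defined in the context. The extended normal-form class is invariant under the material derivative: $L\mathcal G\subseteq\mathcal G$. Consequently, for every integer $j\geq1$, $L^jx$ admits a representation $$L^jx=A_j(t)x+\widetilde A_j(t)\bar y_{x,t}+R_j(t,x),$$ with $A_j,\widetilde A_j\in\mathcal C$ and $R_j\in\mathfrak M$.
   Context: Posterior and material derivative. For $t>0$, $x\in\mathbb R^d$ let $\mu_{x,t}(dy)\propto\exp\left(-\frac{|x-e^{-t/2}y|^2}{2(1-e^{-t})}\right)P_0(dy)$ (a probability measure), $Y\sim\mu_{x,t}$, $\bar y_{x,t}=\mathbb E_{\mu_{x,t}}[Y]$, $Z=Y-\bar y_{x,t}$. Let $p_t$ be the density of $e^{-t/2}X_0+\sqrt{1-e^{-t}}\,G$ ($X_0\sim P_0$, $G\sim N(0,I_d)$ independent). The modified score is $\hat s(t,x)=x+D_x\log p_t(x)=a(t)x+\lambda(t)\bar y_{x,t}$, with $a(t)=-\frac{e^{-t}}{1-e^{-t}}$, $\lambda(t)=\frac{e^{-t/2}}{1-e^{-t}}$. The material derivative is $L=-\partial_t+\frac12D_x[\cdot][\hat s]$, where $D_xV[v]$ denotes the derivative of $V$ in $x$ in direction $v$; $L^jx$ is $L$ applied $j$ times to the identity field $(t,x)\mapsto x$. Normal-form classes. $\mathcal C:=C^\infty((0,\infty))$ (functions of $t$). Admissible vector insertions are built recursively: $\bar y_{x,t}$ is admissible; given admissible insertions $U_1,\dots,U_\ell$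 (vector fields of $(t,x)$), $k,\ell\in\mathbb N_0$, $m\in2\mathbb N_0$, define the vector and scalar atoms $$\mathcal M_{k,m}[U_1,\ldots,U_\ell]:=\mathbb E_{\mu_{x,t}}\Big[Z\langle Z,x\rangle^k|Z|^m\prod_{i=1}^{\ell}\langle Z,U_i\rangle\Big],\quad \mathcal S_{k,m}[U_1,\ldots,U_\ell]:=\mathbb E_{\mu_{x,t}}\Big[\langle Z,x\rangle^k|Z|^m\prod_{i=1}^{\ell}\langle Z,U_i\rangle\Big],$$ where each $U_i=U_i(t,x)$ is held fixed in the outer expectation (empty product $=1$). Every vector atom is itself an admissible insertion; only finitely many recursive steps are allowed. $\mathcal A$ is the commutative $\mathcal C$-algebra generated by the scalar atoms (finite sums of $c(t)\prod_\nu\mathcal S_\nu$, $c\in\mathcal C$, empty product $=1$); $\mathfrak M$ is the $\mathcal A$-module generated by the vector atoms (finite sums of $c(t)(\prod_\nu\mathcal S_\nu)\mathcal M$). Finally $\mathcal G:=\mathcal Cx+\mathcal C\bar y_{x,t}+\mathfrak M$. *)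

theory Defs
  imports "HOL-Probability.Probability"
begin

text \<open>
  Time-dependent fields on $(0,\infty) \times \mathbb{R}^d$ are total functions of type
  \<open>real \<Rightarrow> 'a \<Rightarrow> 'a\<close> or \<open>real \<Rightarrow> 'a \<Rightarrow> real\<close>. Their values for \<open>t \<le> 0\<close> carry no
  meaning: the classes of fields below constrain a field only at times \<open>t > 0\<close>, and derivatives
  are taken at interior points of the time domain.
\<close>

subsection \<open>Posterior and score\<close>

definition posterior_weight :: "real \<Rightarrow> 'a::euclidean_space \<Rightarrow> 'a \<Rightarrow> real" where
  "posterior_weight t x y =
     exp (- (norm (x - exp (- t / 2) *\<^sub>R y))\<^sup>2 / (2 * (1 - exp (- t))))"

definition posterior :: "'a::euclidean_space measure \<Rightarrow> real \<Rightarrow> 'a \<Rightarrow> 'a measure" where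
  "posterior P0 t x =
     density P0 (\<lambda>y. ennreal (posterior_weight t x y / (LINT y'|P0. posterior_weight t x y')))"

definition posterior_mean :: "'a::euclidean_space measure \<Rightarrow> real \<Rightarrow> 'a \<Rightarrow> 'a" where
  "posterior_mean P0 t x = (LINT y|posterior P0 t x. y)"

definition std_gaussian :: "'a::euclidean_space measure" where
  "std_gaussian =
     density lborel (\<lambda>g. ennreal (exp (- (norm g)\<^sup>2 / 2) / sqrt (2 * pi) ^ DIM('a)))"

definition forward_law :: "'a::euclidean_space measure \<Rightarrow> real \<Rightarrow> 'a measure" where
  "forward_law P0 t =
     distr (P0 \<Otimes>\<^sub>M std_gaussian) borel
       (\<lambda>(y, g). exp (- t / 2) *\<^sub>R y + sqrt (1 - exp (- t)) *\<^sub>R g)"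

text \<open>
  A density is determined only almost everywhere; the score needs the continuous version, which is
  the convolution integral. Lemma \<open>forward_law_eq_density\<close> ties it to the law.
\<close>

definition forward_density :: "'a::euclidean_space measure \<Rightarrow> real \<Rightarrow> 'a \<Rightarrow> real" where
  "forward_density P0 t x =
     (LINT y|P0. posterior_weight t x y / sqrt (2 * pi * (1 - exp (- t))) ^ DIM('a))"

lemma forward_law_eq_density:
  fixes P0 :: "'a::euclidean_space measure"
  assumes P0: "prob_space P0" and sets_P0: "sets P0 = sets borel" and t: "t > 0"
  shows "forward_law P0 t = density lborel (\<lambda>x. ennreal (forward_density P0 t x))"
proof -
  interpret P0: prob_space P0 by fact
  note [measurable_cong] = sets_P0
  define \<alpha> where "\<alpha> = exp (- t / 2)"
  define \<beta> where "\<beta> = sqrt (1 - exp (- t))"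
  have \<beta>: "\<beta> > 0" "\<beta>\<^sup>2 = 1 - exp (- t)" using t by (auto simp: \<beta>_def)
  define \<phi> :: "'a \<Rightarrow> real" where "\<phi> g = exp (- (norm g)\<^sup>2 / 2) / sqrt (2 * pi) ^ DIM('a)" for g
  define k :: "'a \<Rightarrow> 'a \<Rightarrow> real" where
    "k x y = posterior_weight t x y / sqrt (2 * pi * (1 - exp (- t))) ^ DIM('a)" for x y
  have [measurable]: "\<phi> \<in> borel_measurable borel" unfolding \<phi>_def by measurable
  have k_pos: "k x y > 0" for x y
    using t by (auto simp: k_def posterior_weight_def)
  have k_le: "k x y \<le> 1 / sqrt (2 * pi * (1 - exp (- t))) ^ DIM('a)" for x y
    using t by (auto simp: k_def posterior_weight_def divide_right_mono)
  have [measurable]: "(\<lambda>(x, y). k x y) \<in> borel_measurable (borel \<Otimes>\<^sub>M borel)"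
    unfolding k_def posterior_weight_def by measurable
  have k_conv: "k (\<alpha> *\<^sub>R y + \<beta> *\<^sub>R g) y * \<beta> ^ DIM('a) = \<phi> g" for y g
  proof -
    have "(norm (\<beta> *\<^sub>R g))\<^sup>2 / (2 * (1 - exp (- t))) = (norm g)\<^sup>2 / 2"
      unfolding \<beta>(2)[symmetric] using \<beta>(1) by (simp add: power_mult_distrib)
    then have "posterior_weight t (\<alpha> *\<^sub>R y + \<beta> *\<^sub>R g) y = exp (- (norm g)\<^sup>2 / 2)"
      unfolding posterior_weight_def \<alpha>_def by simp
    moreover have "sqrt (2 * pi * (1 - exp (- t))) = sqrt (2 * pi) * \<beta>"
      by (simp add: \<beta>_def real_sqrt_mult)
    ultimately show ?thesis
      using \<beta>(1) by (simp add: k_def \<phi>_def power_mult_distrib)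
  qed
  have gauss: "std_gaussian = density lborel (\<lambda>g. ennreal (\<phi> g))"
    by (simp add: std_gaussian_def \<phi>_def)
  have sg: "sigma_finite_measure (std_gaussian :: 'a measure)"
    unfolding gauss by (subst sigma_finite_measure.sigma_finite_iff_density_finite[OF sigma_finite_lborel]) auto
  have setsg [measurable_cong]: "sets (std_gaussian :: 'a measure) = sets borel"
    by (simp add: std_gaussian_def)
  interpret pair_sigma_finite P0 "lborel :: 'a measure" ..
  have dens: "ennreal (forward_density P0 t x) = (\<integral>\<^sup>+y. ennreal (k x y) \<partial>P0)" for x
    unfolding forward_density_def k_def[symmetric]
    using k_pos k_le
    by (intro nn_integral_eq_integral[symmetric] P0.integrable_const_bound
          [where B = "1 / sqrt (2 * pi * (1 - exp (- t))) ^ DIM('a)"])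
       (auto simp: less_imp_le)
  show ?thesis
  proof (rule measure_eqI)
    show "sets (forward_law P0 t) = sets (density lborel (\<lambda>x. ennreal (forward_density P0 t x)))"
      by (simp add: forward_law_def)
  next
    fix A assume "A \<in> sets (forward_law P0 t)"
    then have A [measurable]: "A \<in> sets borel" by (simp add: forward_law_def)
    have "emeasure (forward_law P0 t) A =
        (\<integral>\<^sup>+z. indicator A z \<partial>forward_law P0 t)"
      by (simp add: forward_law_def)
    also have "\<dots> = (\<integral>\<^sup>+z. indicator A (case z of (y, g) \<Rightarrow> \<alpha> *\<^sub>R y + \<beta> *\<^sub>R g)
        \<partial>(P0 \<Otimes>\<^sub>M std_gaussian))"
      unfolding forward_law_def \<alpha>_def \<beta>_def by (rule nn_integral_distr) measurable
    also have "\<dots> = (\<integral>\<^sup>+y. \<integral>\<^sup>+g. indicator A (\<alpha> *\<^sub>R y + \<beta> *\<^sub>R g) \<partial>std_gaussian \<partial>P0)"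
      by (subst sigma_finite_measure.nn_integral_fst[OF sg, symmetric]) auto
    also have "\<dots> = (\<integral>\<^sup>+y. \<integral>\<^sup>+x. ennreal (k x y) * indicator A x \<partial>lborel \<partial>P0)"
    proof (rule nn_integral_cong)
      fix y
      have "(\<integral>\<^sup>+x. ennreal (k x y) * indicator A x \<partial>lborel) =
          (\<integral>\<^sup>+x. ennreal (k x y) * indicator A x
             \<partial>density (distr lborel borel (\<lambda>g. \<alpha> *\<^sub>R y + \<beta> *\<^sub>R g)) (\<lambda>_. \<bar>\<beta>\<bar> ^ DIM('a)))"
        using \<beta>(1) by (subst lborel_affine[of \<beta> "\<alpha> *\<^sub>R y"]) auto
      also have "\<dots> = (\<integral>\<^sup>+g. ennreal (\<beta> ^ DIM('a)) *
          (ennreal (k (\<alpha> *\<^sub>R y + \<beta> *\<^sub>R g) y) * indicator A (\<alpha> *\<^sub>R y + \<beta> *\<^sub>R g)) \<partial>lborel)"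
        using \<beta>(1) by (simp add: nn_integral_density nn_integral_distr)
      also have "\<dots> = (\<integral>\<^sup>+g. ennreal (\<phi> g) * indicator A (\<alpha> *\<^sub>R y + \<beta> *\<^sub>R g) \<partial>lborel)"
        using \<beta>(1) k_pos
        by (intro nn_integral_cong)
           (simp add: k_conv[symmetric, of _ y] ennreal_mult less_imp_le mult_ac)
      also have "\<dots> = (\<integral>\<^sup>+g. indicator A (\<alpha> *\<^sub>R y + \<beta> *\<^sub>R g) \<partial>std_gaussian)"
        unfolding gauss by (simp add: nn_integral_density)
      finally show "(\<integral>\<^sup>+g. indicator A (\<alpha> *\<^sub>R y + \<beta> *\<^sub>R g) \<partial>std_gaussian) =
          (\<integral>\<^sup>+x. ennreal (k x y) * indicator A x \<partial>lborel)" ..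
    qed
    also have "\<dots> = (\<integral>\<^sup>+x. \<integral>\<^sup>+y. ennreal (k x y) * indicator A x \<partial>P0 \<partial>lborel)"
      by (rule Fubini'[symmetric]) measurable
    also have "\<dots> = (\<integral>\<^sup>+x. ennreal (forward_density P0 t x) * indicator A x \<partial>lborel)"
      by (simp add: dens nn_integral_multc)
    also have "\<dots> = emeasure (density lborel (\<lambda>x. ennreal (forward_density P0 t x))) A"
      unfolding dens by (subst emeasure_density) auto
    finally show "emeasure (forward_law P0 t) A =
        emeasure (density lborel (\<lambda>x. ennreal (forward_density P0 t x))) A" .
  qed
qed

text \<open>The derivative $D_x \log p_t(x)$ is identified with the gradient vector.\<close>

definition modified_score :: "'a::euclidean_space measure \<Rightarrow> real \<Rightarrow> 'a \<Rightarrow> 'a" where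
  "modified_score P0 t x = x + (THE g. GDERIV (\<lambda>\<xi>. ln (forward_density P0 t \<xi>)) x :> g)"

subsection \<open>Material derivative\<close>

definition material_deriv ::
    "'a::euclidean_space measure \<Rightarrow> (real \<Rightarrow> 'a \<Rightarrow> 'a) \<Rightarrow> real \<Rightarrow> 'a \<Rightarrow> 'a" where
  "material_deriv P0 V t x =
     - vector_derivative (\<lambda>\<tau>. V \<tau> x) (at t)
     + (1 / 2) *\<^sub>R frechet_derivative (V t) (at x) (modified_score P0 t x)"

text \<open>
  The library derivatives are total, so \<open>material_deriv\<close> is meaningful only on fields for which
  both derivatives exist.
\<close>

definition material_differentiable :: "(real \<Rightarrow> 'a::euclidean_space \<Rightarrow> 'a) \<Rightarrow> bool" where
  "material_differentiable V \<longleftrightarrow>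
     (\<forall>t>0. \<forall>x. (\<lambda>\<tau>. V \<tau> x) differentiable (at t) \<and> V t differentiable (at x))"

subsection \<open>Normal-form classes\<close>

text \<open>The class $C^\infty((0,\infty))$.\<close>

definition smooth_coeffs :: "(real \<Rightarrow> real) set" where
  "smooth_coeffs = {c. \<forall>n. \<forall>t>0. (deriv ^^ n) c differentiable (at t)}"

definition vector_atom :: "'a::euclidean_space measure \<Rightarrow> nat \<Rightarrow> nat \<Rightarrow>
    (real \<Rightarrow> 'a \<Rightarrow> 'a) list \<Rightarrow> real \<Rightarrow> 'a \<Rightarrow> 'a" where
  "vector_atom P0 k m Us t x =
     (LINT y|posterior P0 t x.
        (let z = y - posterior_mean P0 t x
         in ((z \<bullet> x) ^ k * norm z ^ m * (\<Prod>U\<leftarrow>Us. z \<bullet> U t x)) *\<^sub>R z))"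

definition scalar_atom :: "'a::euclidean_space measure \<Rightarrow> nat \<Rightarrow> nat \<Rightarrow>
    (real \<Rightarrow> 'a \<Rightarrow> 'a) list \<Rightarrow> real \<Rightarrow> 'a \<Rightarrow> real" where
  "scalar_atom P0 k m Us t x =
     (LINT y|posterior P0 t x.
        (let z = y - posterior_mean P0 t x
         in (z \<bullet> x) ^ k * norm z ^ m * (\<Prod>U\<leftarrow>Us. z \<bullet> U t x)))"

inductive_set insertions :: "'a::euclidean_space measure \<Rightarrow> (real \<Rightarrow> 'a \<Rightarrow> 'a) set"
  for P0 :: "'a measure" where
  mean: "posterior_mean P0 \<in> insertions P0"
| atom: "\<lbrakk>\<forall>U\<in>set Us. U \<in> insertions P0; even m\<rbrakk> \<Longrightarrow> vector_atom P0 k m Us \<in> insertions P0"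

definition vector_atoms :: "'a::euclidean_space measure \<Rightarrow> (real \<Rightarrow> 'a \<Rightarrow> 'a) set" where
  "vector_atoms P0 = {vector_atom P0 k m Us | k m Us. even m \<and> set Us \<subseteq> insertions P0}"

definition scalar_atoms :: "'a::euclidean_space measure \<Rightarrow> (real \<Rightarrow> 'a \<Rightarrow> real) set" where
  "scalar_atoms P0 = {scalar_atom P0 k m Us | k m Us. even m \<and> set Us \<subseteq> insertions P0}"

text \<open>The algebra $\mathcal{A}$: finite sums of $c(t) \prod_\nu S_\nu(t,x)$.\<close>

definition scalar_algebra :: "'a::euclidean_space measure \<Rightarrow> (real \<Rightarrow> 'a \<Rightarrow> real) set" where
  "scalar_algebra P0 =
     {f. \<exists>ts :: ((real \<Rightarrow> real) \<times> (real \<Rightarrow> 'a \<Rightarrow> real) list) list.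
           (\<forall>(c, Ss)\<in>set ts. c \<in> smooth_coeffs \<and> set Ss \<subseteq> scalar_atoms P0) \<and>
           (\<forall>t>0. \<forall>x. f t x = (\<Sum>(c, Ss)\<leftarrow>ts. c t * (\<Prod>S\<leftarrow>Ss. S t x)))}"

text \<open>The module $\mathfrak{M}$ over \<open>scalar_algebra\<close> generated by the vector atoms.\<close>

definition atom_module :: "'a::euclidean_space measure \<Rightarrow> (real \<Rightarrow> 'a \<Rightarrow> 'a) set" where
  "atom_module P0 =
     {R. \<exists>ts :: ((real \<Rightarrow> 'a \<Rightarrow> real) \<times> (real \<Rightarrow> 'a \<Rightarrow> 'a)) list.
           set ts \<subseteq> scalar_algebra P0 \<times> vector_atoms P0 \<and>
           (\<forall>t>0. \<forall>x. R t x = (\<Sum>(f, M)\<leftarrow>ts. f t x *\<^sub>R M t x))}"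

text \<open>The extended class $\mathcal{G} = \mathcal{C} x + \mathcal{C} \bar y_{x,t} + \mathfrak{M}$.\<close>

definition normal_forms :: "'a::euclidean_space measure \<Rightarrow> (real \<Rightarrow> 'a \<Rightarrow> 'a) set" where
  "normal_forms P0 =
     {V. \<exists>A\<in>smooth_coeffs. \<exists>B\<in>smooth_coeffs. \<exists>R\<in>atom_module P0.
           \<forall>t>0. \<forall>x. V t x = A t *\<^sub>R x + B t *\<^sub>R posterior_mean P0 t x + R t x}"

end

theory Submission
  imports Defs
begin

text \<open>
  Write \<open>a\<close>, \<open>\<lambda>\<close>, \<open>Z\<close>, \<open>\<kappa>\<close> for \<open>score_shift\<close>, \<open>score_gain\<close>, \<open>centered\<close>, \<open>drift\<close>.
  Since \<open>1 / (1 - exp (- t)) = 1 - a\<close>, the posterior weight is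
  \<open>exp ((a - 1)/2 |x|^2 + \<lambda> \<langle>x,y\<rangle> + a/2 |y|^2)\<close>, and \<open>a' = \<lambda>^2\<close>, \<open>\<lambda>' = \<lambda> (a - 1/2)\<close>.
  As \<open>a < 0\<close>, the weight beats every polynomial in \<open>y\<close> locally uniformly in \<open>(t,x)\<close>, so one may
  differentiate under the integral with no moment assumption on \<open>P0\<close>. The material derivative is
  the joint derivative in \<open>(t,x)\<close> along \<open>(-1, s/2)\<close>, where \<open>s\<close> is the modified score, and
  \[ L\,\mathbb{E}[f] = \mathbb{E}[Lf + \kappa f] - \mathbb{E}[\kappa]\,\mathbb{E}[f], \qquad
     \kappa = \frac{\lambda(1-a)}{2} \langle Z,x\rangle - \frac{\lambda^2}{2} \langle Z,\bar y\rangle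
       - \frac{\lambda^2}{2} |Z|^2. \]
  Hence \<open>L ybar = E[\<kappa> Z]\<close> lies in the atom module. The integrands that are combinations, with
  coefficients in the scalar algebra, of monomials in \<open>\<langle>Z,x\<rangle>\<close>, \<open>|Z|^2\<close> and \<open>\<langle>Z,U\<rangle>\<close> contain
  \<open>\<kappa>\<close> and are closed under \<open>L\<close>, because pairing a vector atom with \<open>x\<close> or an insertion gives a
  scalar atom; their averages are the scalar and vector atoms.
\<close>

subsection \<open>Smooth coefficients and the posterior weight\<close>

text \<open>Coinduction for smoothness: iterating the hypothesis, each iterated derivative agrees at
  positive times with a member of \<open>F\<close>, and since \<open>{0<..}\<close> is open this
  agreement survives one more differentiation. No higher derivative ever has to be computed.\<close>

lemma smooth_coeffs_coinduct:
  assumes closed: "\<And>f. f \<in> F \<Longrightarrow> \<exists>g\<in>F. \<forall>t>0. (f has_real_derivative g t) (at t)"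
  shows "F \<subseteq> smooth_coeffs"
proof
  fix f assume f: "f \<in> F"
  have iter: "\<exists>g\<in>F. \<forall>t>0. (deriv ^^ n) f t = g t" for n
  proof (induction n)
    case 0
    show ?case using f by auto
  next
    case (Suc n)
    then obtain g where g: "g \<in> F" "\<And>t. t > 0 \<Longrightarrow> (deriv ^^ n) f t = g t" by auto
    obtain g' where g': "g' \<in> F" "\<And>t. t > 0 \<Longrightarrow> (g has_real_derivative g' t) (at t)"
      using closed[OF g(1)] by auto
    have "((deriv ^^ n) f has_real_derivative g' t) (at t)" if "t > 0" for t
      by (rule has_field_derivative_transform_within_open[OF g'(2)[OF that], of "{0<..}"])
         (use that g(2) in auto)
    then have "(deriv ^^ Suc n) f t = g' t" if "t > 0" for t
      using that by (auto intro: DERIV_imp_deriv)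
    then show ?case using g'(1) by auto
  qed
  have "(deriv ^^ n) f differentiable (at t)" if "t > 0" for n t
  proof -
    obtain g where g: "g \<in> F" "\<And>t. t > 0 \<Longrightarrow> (deriv ^^ n) f t = g t" using iter by blast
    obtain g' where g': "\<And>t. t > 0 \<Longrightarrow> (g has_real_derivative g' t) (at t)"
      using closed[OF g(1)] by auto
    have "((deriv ^^ n) f has_real_derivative g' t) (at t)"
      by (rule has_field_derivative_transform_within_open[OF g'[OF that], of "{0<..}"])
         (use that g(2) in auto)
    then show ?thesis by (auto simp: real_differentiable_def)
  qed
  then show "f \<in> smooth_coeffs" by (auto simp: smooth_coeffs_def)
qed

lemma smooth_coeffs_deriv:
  assumes "c \<in> smooth_coeffs"
  shows "deriv c \<in> smooth_coeffs" "t > 0 \<Longrightarrow> (c has_real_derivative deriv c t) (at t)"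
proof -
  have d: "(deriv ^^ n) c differentiable (at t)" if "t > 0" for n t
    using assms that by (auto simp: smooth_coeffs_def)
  have "(deriv ^^ n) (deriv c) differentiable (at t)" if "t > 0" for n t
    using d[OF that, of "Suc n"] by (simp add: funpow_swap1)
  then show "deriv c \<in> smooth_coeffs" by (auto simp: smooth_coeffs_def)
  show "t > 0 \<Longrightarrow> (c has_real_derivative deriv c t) (at t)"
    using d[of t 0] by (auto simp: real_differentiable_def dest: DERIV_imp_deriv)
qed

section \<open>The score coefficients and the differential equations they satisfy\<close>

definition score_shift :: "real \<Rightarrow> real" where
  "score_shift t = - exp (- t) / (1 - exp (- t))"

definition score_gain :: "real \<Rightarrow> real" where
  "score_gain t = exp (- t / 2) / (1 - exp (- t))"

lemma score_shift_deriv: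
  assumes "t > 0"
  shows "(score_shift has_real_derivative (score_gain t)\<^sup>2) (at t)"
proof -
  have e: "(exp (- t / 2))\<^sup>2 = exp (- t)" by (simp flip: exp_double)
  have "(score_shift has_real_derivative
      (exp (- t) * (1 - exp (- t)) + exp (- t) * exp (- t)) / (1 - exp (- t))\<^sup>2) (at t)"
    unfolding score_shift_def using assms
    by (auto intro!: derivative_eq_intros simp: power2_eq_square field_simps)
  \<comment> \<open>The numerator collapses to \<open>exp (- t)\<close>, which is the square of
    \<open>exp (- t / 2)\<close>.\<close>
  also have "(exp (- t) * (1 - exp (- t)) + exp (- t) * exp (- t)) / (1 - exp (- t))\<^sup>2
      = (score_gain t)\<^sup>2"
    unfolding score_gain_def power_divide e by (simp add: algebra_simps)
  finally show ?thesis .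
qed

lemma score_gain_deriv:
  assumes "t > 0"
  shows "(score_gain has_real_derivative score_gain t * (score_shift t - 1 / 2)) (at t)"
proof -
  have "(score_gain has_real_derivative
      (- (exp (- t / 2) / 2) * (1 - exp (- t)) - exp (- t / 2) * exp (- t))
        / ((1 - exp (- t)) * (1 - exp (- t)))) (at t)"
    unfolding score_gain_def using assms
    by (auto intro!: derivative_eq_intros)
  also have "(- (exp (- t / 2) / 2) * (1 - exp (- t)) - exp (- t / 2) * exp (- t))
        / ((1 - exp (- t)) * (1 - exp (- t))) = score_gain t * (score_shift t - 1 / 2)"
    using assms by (simp add: score_gain_def score_shift_def divide_simps) (simp add: algebra_simps)
  finally show ?thesis .
qed

text \<open>Auxiliary syntax for proving that the smooth coefficients form a ring containing a and
  \<lambda>. The equations for a' and \<lambda>' together with the Leibniz rule close this set under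
  differentiation, so coinduction shows that it adds nothing to \<open>smooth_coeffs\<close>, and
  its introduction rules become closure rules.\<close>

inductive_set coeff_ring :: "(real \<Rightarrow> real) set" where
  base: "c \<in> smooth_coeffs \<Longrightarrow> c \<in> coeff_ring"
| const: "(\<lambda>_. r) \<in> coeff_ring"
| shift: "score_shift \<in> coeff_ring"
| gain: "score_gain \<in> coeff_ring"
| add: "c \<in> coeff_ring \<Longrightarrow> d \<in> coeff_ring \<Longrightarrow> (\<lambda>t. c t + d t) \<in> coeff_ring"
| mult: "c \<in> coeff_ring \<Longrightarrow> d \<in> coeff_ring \<Longrightarrow> (\<lambda>t. c t * d t) \<in> coeff_ring"

lemma smooth_coeffs_eq: "smooth_coeffs = coeff_ring"
proof
  show "coeff_ring \<subseteq> smooth_coeffs"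
  proof (rule smooth_coeffs_coinduct)
    fix f :: "real \<Rightarrow> real" assume "f \<in> coeff_ring"
    then show "\<exists>g\<in>coeff_ring. \<forall>t>0. (f has_real_derivative g t) (at t)"
    proof induction
      case (base c)
      then show ?case using smooth_coeffs_deriv[of c] coeff_ring.base by blast
    next
      case (const r)
      show ?case using coeff_ring.const[of 0] by (auto intro!: bexI[of _ "\<lambda>_. 0"])
    next
      case shift
      have "(\<lambda>t. score_gain t * score_gain t) \<in> coeff_ring"
        by (intro coeff_ring.intros)
      then show ?case using score_shift_deriv
        by (intro bexI[of _ "\<lambda>t. score_gain t * score_gain t"]) (simp_all add: power2_eq_square)
    next
      case gain
      have "(\<lambda>t. score_gain t * (score_shift t + (- 1 / 2))) \<in> coeff_ring"
        by (intro coeff_ring.intros)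
      then show ?case using score_gain_deriv
        by (intro bexI[of _ "\<lambda>t. score_gain t * (score_shift t + (- 1 / 2))"]) simp_all
    next
      case (add c d)
      then obtain c' d' where *: "c' \<in> coeff_ring" "d' \<in> coeff_ring"
        "\<forall>t>0. (c has_real_derivative c' t) (at t)" "\<forall>t>0. (d has_real_derivative d' t) (at t)"
        by auto
      then show ?case
        by (intro bexI[of _ "\<lambda>t. c' t + d' t"]) (auto intro!: coeff_ring.add derivative_eq_intros)
    next
      case (mult c d)
      then obtain c' d' where *: "c' \<in> coeff_ring" "d' \<in> coeff_ring"
        "\<forall>t>0. (c has_real_derivative c' t) (at t)" "\<forall>t>0. (d has_real_derivative d' t) (at t)"
        by auto
      then show ?case using mult.hyps
        by (intro bexI[of _ "\<lambda>t. c' t * d t + d' t * c t"])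
           (auto intro!: coeff_ring.add coeff_ring.mult DERIV_mult)
    qed
  qed
qed (auto intro: coeff_ring.base)

lemmas smooth_coeffs_intros = coeff_ring.const[folded smooth_coeffs_eq]
  coeff_ring.shift[folded smooth_coeffs_eq] coeff_ring.gain[folded smooth_coeffs_eq]
  coeff_ring.add[folded smooth_coeffs_eq] coeff_ring.mult[folded smooth_coeffs_eq]

lemma posterior_weight_eq:
  assumes "t > 0"
  shows "posterior_weight t x y =
    exp (- (1 - score_shift t) * (x \<bullet> x) / 2 + score_gain t * (x \<bullet> y) + score_shift t * (y \<bullet> y) / 2)"
proof -
  have e: "exp (- t / 2) * exp (- t / 2) = exp (- t)" by (simp flip: exp_add)
  have v: "1 - exp (- t) > 0" using assms by simp
  have n: "(norm (x - exp (- t / 2) *\<^sub>R y))\<^sup>2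
      = x \<bullet> x - 2 * exp (- t / 2) * (x \<bullet> y) + exp (- t) * (y \<bullet> y)"
    unfolding power2_norm_eq_inner
    by (simp add: inner_diff_left inner_diff_right inner_commute algebra_simps flip: e)
  \<comment> \<open>The rational identity behind the exponent, read with
    \<open>w = exp (- t)\<close>, \<open>b = exp (- t / 2)\<close> and p, q, r the inner products of
    x with x, x with y, and y with y.\<close>
  have "- (p - 2 * b * q + w * r) / (2 * (1 - w))
      = - (1 - - w / (1 - w)) * p / 2 + b / (1 - w) * q + - w / (1 - w) * r / 2"
    if "w < 1" for p q r b w :: real
  proof -
    have "1 - - w / (1 - w) = 1 / (1 - w)" using that by (simp add: divide_simps)
    then show ?thesis using that by (simp add: divide_simps) (simp add: algebra_simps)
  qed
  then show ?thesis
    unfolding posterior_weight_def n score_shift_def score_gain_def using assms by simp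
qed

text \<open>The mean value inequality turns the uniform derivative bound into a Lipschitz bound in
  the parameter. The first-order remainder divided by the increment is then bounded by
  \<open>C + C\<close>, which is integrable over a finite measure, so dominated convergence
  applies.\<close>

lemma has_derivative_integral_bounded:
  fixes f :: "'p::real_normed_vector \<Rightarrow> 'y \<Rightarrow> 'b::{banach, second_countable_topology}"
  assumes M: "finite_measure M" and e: "e > 0"
    and meas: "\<And>q. q \<in> ball p e \<Longrightarrow> f q \<in> borel_measurable M"
    and meas': "\<And>h. (\<lambda>y. f' p y h) \<in> borel_measurable M"
    and int: "integrable M (f p)"
    and deriv: "\<And>q y. q \<in> ball p e \<Longrightarrow> ((\<lambda>q. f q y) has_derivative f' q y) (at q)"
    and bound: "\<And>q y h. q \<in> ball p e \<Longrightarrow> norm (f' q y h) \<le> C * norm h"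
  shows "((\<lambda>q. \<integral>y. f q y \<partial>M) has_derivative (\<lambda>h. \<integral>y. f' p y h \<partial>M)) (at p)"
proof -
  interpret finite_measure M by fact
  have C: "C * norm h \<ge> 0" for h :: 'p
    by (rule order_trans[OF norm_ge_zero bound[of p]]) (use e in auto)
  have lip: "norm (f q y - f p y) \<le> C * norm (q - p)" if "q \<in> ball p e" for q y
  \<comment> \<open>Nonnegativity of \<open>C\<close> is read off the nonzero direction
    \<open>q - p\<close>, hence the separate trivial case.\<close>
  proof (cases "q = p")
    case False
    then have "C \<ge> 0" using C[of "q - p"] by (simp add: zero_le_mult_iff)
    moreover have "onorm (f' z y) \<le> C" if "z \<in> ball p e" for z
      using \<open>C \<ge> 0\<close> bound[OF that] by (intro onorm_bound) auto
    ultimately show ?thesis using e that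
      by (intro differentiable_bound[where S = "ball p e" and f' = "\<lambda>z. f' z y"])
         (auto intro!: has_derivative_at_withinI deriv)
  qed simp
  have lin: "bounded_linear (f' p y)" for y
    using deriv[of p y] e by (auto intro: has_derivative_bounded_linear)
  have int': "integrable M (\<lambda>y. f' p y h)" for h
    by (rule integrable_const_bound[where B = "C * norm h"]) (use e meas' bound in auto)
  have intq: "integrable M (f q)" if "q \<in> ball p e" for q
  proof -
    have "integrable M (\<lambda>y. f q y - f p y)"
      by (rule integrable_const_bound[where B = "C * norm (q - p)"])
         (use that e lip meas in auto)
    from Bochner_Integration.integrable_add[OF this int] show ?thesis by simp
  qed
  \<comment> \<open>Dominated convergence is a statement about sequences, so the limit at
    \<open>p\<close> is tested along arbitrary sequences avoiding \<open>p\<close>.\<close>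
  have "((\<lambda>q. ((\<integral>y. f q y \<partial>M) - (\<integral>y. f p y \<partial>M) - (\<integral>y. f' p y (q - p) \<partial>M)) /\<^sub>R norm (q - p)) \<longlongrightarrow> 0) (at p)"
    unfolding tendsto_at_iff_sequentially
  proof (intro allI impI)
    fix X :: "nat \<Rightarrow> 'p" assume X: "\<forall>i. X i \<in> UNIV - {p}" "X \<longlonglongrightarrow> p"
    have "eventually (\<lambda>i. X i \<in> ball p e) sequentially"
      using X(2) e by (auto simp: tendsto_iff dist_commute)
    then obtain N where N: "\<And>i. i \<ge> N \<Longrightarrow> X i \<in> ball p e" by (auto simp: eventually_sequentially)
    \<comment> \<open>Dropping the first \<open>N\<close> terms puts the whole sequence inside the
      ball where the bounds hold.\<close>
    define Y where "Y i = X (i + N)" for i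
    have Y: "Y i \<in> ball p e" "Y i \<noteq> p" for i using N X(1) by (auto simp: Y_def)
    have Yl: "Y \<longlonglongrightarrow> p" unfolding Y_def using X(2) by (rule LIMSEQ_ignore_initial_segment)
    define r where "r q y = (f q y - f p y - f' p y (q - p)) /\<^sub>R norm (q - p)" for q y
    \<comment> \<open>One \<open>C\<close> of the dominating constant comes from the Lipschitz
      bound, the other from the linear term.\<close>
    have "(\<lambda>i. \<integral>y. r (Y i) y \<partial>M) \<longlonglongrightarrow> (\<integral>y. 0 \<partial>M)"
    proof (rule integral_dominated_convergence[where w = "\<lambda>_. C + C"])
      show "r (Y i) \<in> borel_measurable M" for i
      proof -
        have [measurable]: "f (Y i) \<in> borel_measurable M" "f p \<in> borel_measurable M"
          "(\<lambda>y. f' p y (Y i - p)) \<in> borel_measurable M"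
          using meas Y(1) meas' e by auto
        show ?thesis unfolding r_def by measurable
      qed
      show "AE y in M. (\<lambda>i. r (Y i) y) \<longlonglongrightarrow> 0"
      proof (rule AE_I2)
        fix y
        have "((\<lambda>q. r q y) \<longlongrightarrow> 0) (at p)"
          using deriv[of p y] e unfolding has_derivative_at_within r_def by auto
        then show "(\<lambda>i. r (Y i) y) \<longlonglongrightarrow> 0"
          using Y(2) Yl unfolding tendsto_at_iff_sequentially o_def by auto
      qed
      show "AE y in M. norm (r (Y i) y) \<le> C + C" for i
      proof (rule AE_I2)
        fix y
        have pos: "norm (Y i - p) > 0" using Y(2)[of i] by simp
        have "norm (f (Y i) y - f p y - f' p y (Y i - p))
            \<le> C * norm (Y i - p) + C * norm (Y i - p)"
          by (rule order_trans[OF norm_triangle_ineq4 add_mono]) (use lip Y bound e in auto)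
        then show "norm (r (Y i) y) \<le> C + C"
          using pos unfolding r_def norm_scaleR abs_inverse abs_norm_cancel
          by (simp only: mult.commute[of "inverse _"] divide_inverse[symmetric] pos_divide_le_eq distrib_right)
      qed
    qed auto
    moreover have "(\<integral>y. r (Y i) y \<partial>M) = ((\<integral>y. f (Y i) y \<partial>M) - (\<integral>y. f p y \<partial>M)
        - (\<integral>y. f' p y (Y i - p) \<partial>M)) /\<^sub>R norm (Y i - p)" for i
      unfolding r_def using intq[OF Y(1)] int int' by simp
    ultimately have "(\<lambda>i. ((\<integral>y. f (Y i) y \<partial>M) - (\<integral>y. f p y \<partial>M)
        - (\<integral>y. f' p y (Y i - p) \<partial>M)) /\<^sub>R norm (Y i - p)) \<longlonglongrightarrow> 0" by simp
    then show "((\<lambda>q. ((\<integral>y. f q y \<partial>M) - (\<integral>y. f p y \<partial>M) - (\<integral>y. f' p y (q - p) \<partial>M)) /\<^sub>R norm (q - p)) \<circ> X) \<longlonglongrightarrow> 0"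
      unfolding Y_def o_def by (rule LIMSEQ_offset)
  qed
  moreover have "bounded_linear (\<lambda>h. \<integral>y. f' p y h \<partial>M)"
  proof (rule bounded_linear_intro[where K = "C * measure M (space M)"])
    fix h k r
    show "(\<integral>y. f' p y (h + k) \<partial>M) = (\<integral>y. f' p y h \<partial>M) + (\<integral>y. f' p y k \<partial>M)"
      using int' by (simp add: linear_simps[OF lin])
    show "(\<integral>y. f' p y (r *\<^sub>R h) \<partial>M) = r *\<^sub>R (\<integral>y. f' p y h \<partial>M)"
      by (simp add: linear_simps[OF lin])
    have "norm (\<integral>y. f' p y h \<partial>M) \<le> (\<integral>y. C * norm h \<partial>M)"
      using int' e bound by (intro order_trans[OF integral_norm_bound integral_mono]) auto
    then show "norm (\<integral>y. f' p y h \<partial>M) \<le> norm h * (C * measure M (space M))"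
      by (simp add: mult_ac)
  qed
  ultimately show ?thesis by (simp add: has_derivative_at_within)
qed

subsection \<open>Integrands of locally uniform polynomial growth\<close>

text \<open>The base \<open>1 + norm y\<close> is at least 1, so its powers increase with the
  exponent and different degrees can be merged into one.\<close>

definition poly_growth :: "('a::real_normed_vector \<Rightarrow> 'b::real_normed_vector) \<Rightarrow> bool" where
  "poly_growth f \<longleftrightarrow> f \<in> borel_measurable borel \<and>
     (\<exists>C\<ge>0. \<exists>n. \<forall>y. norm (f y) \<le> C * (1 + norm y) ^ n)"

lemma poly_growthI:
  assumes "f \<in> borel_measurable borel" "\<And>y. norm (f y) \<le> C * (1 + norm y) ^ n"
  shows "poly_growth f"
proof -
  have "C \<ge> 0" using order_trans[OF norm_ge_zero assms(2)[of 0]] by simp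
  then show ?thesis using assms by (auto simp: poly_growth_def)
qed

text \<open>The exponent \<open>m + n\<close> dominates both degrees and is also the degree of a
  product, so sums and products share one bookkeeping scheme.\<close>

lemma pow_bound_add:
  fixes r :: real
  assumes "r \<ge> 1" "C \<ge> 0" "D \<ge> 0" "u \<le> C * r ^ m" "v \<le> D * r ^ n"
  shows "u + v \<le> (C + D) * r ^ (m + n)"
proof -
  have "r ^ m \<le> r ^ (m + n)" "r ^ n \<le> r ^ (m + n)" using assms(1) by (auto intro: power_increasing)
  then have "C * r ^ m \<le> C * r ^ (m + n)" "D * r ^ n \<le> D * r ^ (m + n)"
    using assms(2,3) by (auto intro: mult_left_mono)
  then show ?thesis using assms(4,5) by (simp add: algebra_simps)
qed

lemma pow_bound_mult:
  fixes r :: real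
  assumes "r \<ge> 1" "C \<ge> 0" "D \<ge> 0" "0 \<le> u" "0 \<le> v" "u \<le> C * r ^ m" "v \<le> D * r ^ n"
  shows "u * v \<le> (C * D) * r ^ (m + n)"
proof -
  have "u * v \<le> (C * r ^ m) * (D * r ^ n)" using assms by (intro mult_mono) auto
  then show ?thesis by (simp add: power_add mult_ac)
qed

lemma poly_growth_const: "poly_growth (\<lambda>_. c)"
  by (rule poly_growthI[where C = "norm c" and n = 0]) auto

lemma poly_growth_id: "poly_growth (\<lambda>y::'a::euclidean_space. y)"
  by (rule poly_growthI[where C = 1 and n = 1]) auto

lemma poly_growth_add:
  fixes f g :: "'a::euclidean_space \<Rightarrow> 'b::euclidean_space"
  assumes "poly_growth f" "poly_growth g"
  shows "poly_growth (\<lambda>y. f y + g y)"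
proof -
  obtain C m D n where *: "C \<ge> 0" "\<And>y. norm (f y) \<le> C * (1 + norm y) ^ m"
    "D \<ge> 0" "\<And>y. norm (g y) \<le> D * (1 + norm y) ^ n"
    using assms by (auto simp: poly_growth_def)
  show ?thesis
  proof (rule poly_growthI)
    show "(\<lambda>y. f y + g y) \<in> borel_measurable borel" using assms by (auto simp: poly_growth_def)
    show "norm (f y + g y) \<le> (C + D) * (1 + norm y) ^ (m + n)" for y
      by (rule order_trans[OF norm_triangle_ineq pow_bound_add]) (use * in auto)
  qed
qed

lemma poly_growth_bilinear:
  fixes f :: "'a::euclidean_space \<Rightarrow> 'b::euclidean_space"
    and g :: "'a \<Rightarrow> 'c::euclidean_space"
    and B :: "'b \<Rightarrow> 'c \<Rightarrow> 'd::euclidean_space"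
  assumes B: "bounded_bilinear B" and "poly_growth f" "poly_growth g"
  shows "poly_growth (\<lambda>y. B (f y) (g y))"
proof -
  obtain C m D n where *: "C \<ge> 0" "\<And>y. norm (f y) \<le> C * (1 + norm y) ^ m"
    "D \<ge> 0" "\<And>y. norm (g y) \<le> D * (1 + norm y) ^ n"
    using assms by (auto simp: poly_growth_def)
  obtain K where K: "K \<ge> 0" "\<And>a b. norm (B a b) \<le> norm a * norm b * K"
    using bounded_bilinear.nonneg_bounded[OF B] by auto
  show ?thesis
  proof (rule poly_growthI)
    show "(\<lambda>y. B (f y) (g y)) \<in> borel_measurable borel"
      by (rule borel_measurable_continuous_Pair)
         (use assms(2,3) in \<open>auto simp: poly_growth_def
           intro!: bounded_bilinear.continuous_on[OF B] continuous_on_fst continuous_on_snd continuous_on_id\<close>)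
    show "norm (B (f y) (g y)) \<le> (C * D * K) * (1 + norm y) ^ (m + n)" for y
    proof -
      have "norm (f y) * norm (g y) \<le> (C * D) * (1 + norm y) ^ (m + n)"
        by (rule pow_bound_mult) (use * in auto)
      from mult_right_mono[OF this K(1)] show ?thesis
        by (intro order_trans[OF K(2)]) (simp add: mult_ac)
    qed
  qed
qed

lemmas poly_growth_scaleR = poly_growth_bilinear[OF bounded_bilinear_scaleR]
lemmas poly_growth_inner = poly_growth_bilinear[OF bounded_bilinear_inner]
lemmas poly_growth_mult = poly_growth_bilinear[OF bounded_bilinear_mult]

text \<open>The families to which differentiation under the weighted integral applies: the parameter
  is p = (t,x), and \<open>g'\<close> is the joint derivative in p with y fixed. The derivative is
  an explicit argument so that it can later be evaluated along a chosen direction. The bounds use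
  \<open>nhds p\<close>, so they include the point p itself.\<close>

definition moderate ::
    "(real \<times> 'a::euclidean_space \<Rightarrow> 'a \<Rightarrow> 'b::euclidean_space) \<Rightarrow>
     (real \<times> 'a \<Rightarrow> 'a \<Rightarrow> real \<times> 'a \<Rightarrow> 'b) \<Rightarrow> bool" where
  "moderate g g' \<longleftrightarrow> (\<forall>p. fst p > 0 \<longrightarrow>
     g p \<in> borel_measurable borel \<and> (\<forall>h. (\<lambda>y. g' p y h) \<in> borel_measurable borel) \<and>
     (\<forall>y. ((\<lambda>q. g q y) has_derivative g' p y) (at p)) \<and>
     (\<exists>C\<ge>0. \<exists>n. \<forall>\<^sub>F q in nhds p. \<forall>y. norm (g q y) \<le> C * (1 + norm y) ^ n \<and>
        (\<forall>h. norm (g' q y h) \<le> C * (1 + norm y) ^ n * norm h)))"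

lemma moderateE:
  assumes "moderate g g'" "fst p > 0"
  obtains C n where "C \<ge> 0" "\<forall>\<^sub>F q in nhds p. \<forall>y. norm (g q y) \<le> C * (1 + norm y) ^ n \<and>
    (\<forall>h. norm (g' q y h) \<le> C * (1 + norm y) ^ n * norm h)"
  using assms unfolding moderate_def by blast

lemma moderateD:
  assumes "moderate g g'" "fst p > 0"
  shows "g p \<in> borel_measurable borel" "(\<lambda>y. g' p y h) \<in> borel_measurable borel"
    "((\<lambda>q. g q y) has_derivative g' p y) (at p)"
    "poly_growth (g p)" "poly_growth (\<lambda>y. g' p y h)"
proof -
  show m: "g p \<in> borel_measurable borel" "(\<lambda>y. g' p y h) \<in> borel_measurable borel"
    "((\<lambda>q. g q y) has_derivative g' p y) (at p)"
    using assms unfolding moderate_def by blast+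
  obtain C n where "\<forall>\<^sub>F q in nhds p. \<forall>y. norm (g q y) \<le> C * (1 + norm y) ^ n \<and>
        (\<forall>h. norm (g' q y h) \<le> C * (1 + norm y) ^ n * norm h)"
    using moderateE[OF assms] by blast
  from eventually_nhds_x_imp_x[OF this]
  have "norm (g p y) \<le> C * (1 + norm y) ^ n" "norm (g' p y h) \<le> (C * norm h) * (1 + norm y) ^ n" for y
    by (auto simp only: mult_ac)
  with m show "poly_growth (g p)" "poly_growth (\<lambda>y. g' p y h)"
    by (auto intro: poly_growthI)
qed

lemma isCont_tendsto_nhds: "isCont f p \<Longrightarrow> (f \<longlongrightarrow> f p) (nhds p)"
  by (simp add: isCont_def tendsto_at_iff_tendsto_nhds)

lemma eventually_nhds_norm_le:
  fixes u :: "'p::t2_space \<Rightarrow> 'b::real_normed_vector"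
  assumes "isCont u p"
  shows "\<forall>\<^sub>F q in nhds p. norm (u q) \<le> norm (u p) + 1"
proof -
  have "((\<lambda>q. norm (u q)) \<longlongrightarrow> norm (u p)) (nhds p)"
    using assms by (intro tendsto_norm isCont_tendsto_nhds)
  from order_tendstoD(2)[OF this, of "norm (u p) + 1"] show ?thesis
    by (auto elim: eventually_mono)
qed

lemma eventually_nhds_pos: "fst p > 0 \<Longrightarrow> \<forall>\<^sub>F q in nhds (p :: real \<times> 'a::metric_space). fst q > 0"
proof -
  assume p: "fst p > 0"
  have "open ({0<..} \<times> UNIV :: (real \<times> 'a) set)" by (intro open_Times) auto
  from eventually_nhds_in_open[OF this, of p] show ?thesis using p
    by (auto elim: eventually_mono simp: mem_Times_iff)
qed

text \<open>The half-space of positive times is open, so agreement there transfers derivatives and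
  local bounds.\<close>

lemma moderate_cong:
  assumes g: "moderate g g'"
    and eq: "\<And>p y. fst p > 0 \<Longrightarrow> f p y = g p y"
    and eq': "\<And>p y h. fst p > 0 \<Longrightarrow> f' p y h = g' p y h"
  shows "moderate f f'"
  unfolding moderate_def
proof (intro allI impI conjI)
  fix p :: "real \<times> 'a" and y h assume p: "fst p > 0"
  note ev = eventually_nhds_pos[OF p]
  have [simp]: "f p = g p" "f' p = g' p" using eq[OF p] eq'[OF p] by (intro ext; simp only:)+
  show "f p \<in> borel_measurable borel" "(\<lambda>y. f' p y h) \<in> borel_measurable borel"
    using moderateD[OF g p] by auto
  have "open ({0<..} \<times> UNIV :: (real \<times> 'a) set)" by (intro open_Times) auto
  then have "((\<lambda>q. f q y) has_derivative g' p y) (at p)"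
    by (rule has_derivative_transform_within_open[OF moderateD(3)[OF g p]])
       (use p eq in \<open>auto simp: mem_Times_iff\<close>)
  then show "((\<lambda>q. f q y) has_derivative f' p y) (at p)" by simp
  obtain C n where C: "C \<ge> 0" "\<forall>\<^sub>F q in nhds p. \<forall>y. norm (g q y) \<le> C * (1 + norm y) ^ n \<and>
        (\<forall>h. norm (g' q y h) \<le> C * (1 + norm y) ^ n * norm h)"
    using moderateE[OF g p] by blast
  show "\<exists>C\<ge>0. \<exists>n. \<forall>\<^sub>F q in nhds p. \<forall>y. norm (f q y) \<le> C * (1 + norm y) ^ n \<and>
        (\<forall>h. norm (f' q y h) \<le> C * (1 + norm y) ^ n * norm h)"
    by (intro exI[of _ C] conjI exI[of _ n] C eventually_mono[OF eventually_conj[OF ev C(2)]])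
       (simp add: eq eq')
qed

lemma moderate_add:
  assumes f: "moderate f f'" and g: "moderate g g'"
  shows "moderate (\<lambda>p y. f p y + g p y) (\<lambda>p y h. f' p y h + g' p y h)"
  unfolding moderate_def
proof (intro allI impI conjI)
  fix p :: "real \<times> 'a" and y h assume p: "fst p > 0"
  note [measurable] = moderateD(1,2)[OF f p] moderateD(1,2)[OF g p]
  show "(\<lambda>y. f p y + g p y) \<in> borel_measurable borel"
    "(\<lambda>y. f' p y h + g' p y h) \<in> borel_measurable borel" by measurable
  show "((\<lambda>q. f q y + g q y) has_derivative (\<lambda>h. f' p y h + g' p y h)) (at p)"
    by (intro has_derivative_add moderateD(3)[OF f p] moderateD(3)[OF g p])
  obtain C m where C: "C \<ge> 0" "\<forall>\<^sub>F q in nhds p. \<forall>y. norm (f q y) \<le> C * (1 + norm y) ^ m \<and>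
        (\<forall>h. norm (f' q y h) \<le> C * (1 + norm y) ^ m * norm h)"
    using moderateE[OF f p] by blast
  obtain D n where D: "D \<ge> 0" "\<forall>\<^sub>F q in nhds p. \<forall>y. norm (g q y) \<le> D * (1 + norm y) ^ n \<and>
        (\<forall>h. norm (g' q y h) \<le> D * (1 + norm y) ^ n * norm h)"
    using moderateE[OF g p] by blast
  show "\<exists>C\<ge>0. \<exists>n. \<forall>\<^sub>F q in nhds p. \<forall>y. norm (f q y + g q y) \<le> C * (1 + norm y) ^ n \<and>
        (\<forall>h. norm (f' q y h + g' q y h) \<le> C * (1 + norm y) ^ n * norm h)"
  proof (intro exI[of _ "C + D"] conjI exI[of _ "m + n"] eventually_mono[OF eventually_conj[OF C(2) D(2)]] allI)
    show "C + D \<ge> 0" using C D by simp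
    fix q y h
    assume a: "(\<forall>y. norm (f q y) \<le> C * (1 + norm y) ^ m \<and>
        (\<forall>h. norm (f' q y h) \<le> C * (1 + norm y) ^ m * norm h)) \<and>
       (\<forall>y. norm (g q y) \<le> D * (1 + norm y) ^ n \<and>
        (\<forall>h. norm (g' q y h) \<le> D * (1 + norm y) ^ n * norm h))"
    show "norm (f q y + g q y) \<le> (C + D) * (1 + norm y) ^ (m + n)"
      by (rule order_trans[OF norm_triangle_ineq pow_bound_add]) (use a C D in auto)
    have "norm (f' q y h) \<le> (C * norm h) * (1 + norm y) ^ m"
      "norm (g' q y h) \<le> (D * norm h) * (1 + norm y) ^ n" using a by (simp_all add: mult_ac del: split_paired_All)
    then have "norm (f' q y h + g' q y h) \<le> (C * norm h + D * norm h) * (1 + norm y) ^ (m + n)"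
      by (intro order_trans[OF norm_triangle_ineq pow_bound_add]) (use C D in auto)
    then show "norm (f' q y h + g' q y h) \<le> (C + D) * (1 + norm y) ^ (m + n) * norm h"
      by (simp add: algebra_simps)
  qed
qed

text \<open>A single Leibniz rule that serves inner products, products and scalar multiples at
  once.\<close>

lemma moderate_bilinear:
  fixes B :: "'b::euclidean_space \<Rightarrow> 'c::euclidean_space \<Rightarrow> 'd::euclidean_space"
  assumes B: "bounded_bilinear B" and f: "moderate f f'" and g: "moderate g g'"
  shows "moderate (\<lambda>p y. B (f p y) (g p y)) (\<lambda>p y h. B (f p y) (g' p y h) + B (f' p y h) (g p y))"
  unfolding moderate_def
proof (intro allI impI conjI)
  fix p :: "real \<times> 'a" and y h assume p: "fst p > 0"
  show "(\<lambda>y. B (f p y) (g p y)) \<in> borel_measurable borel"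
    "(\<lambda>y. B (f p y) (g' p y h) + B (f' p y h) (g p y)) \<in> borel_measurable borel"
    using poly_growth_bilinear[OF B moderateD(4)[OF f p] moderateD(4)[OF g p]]
      poly_growth_add[OF poly_growth_bilinear[OF B moderateD(4)[OF f p] moderateD(5)[OF g p]]
        poly_growth_bilinear[OF B moderateD(5)[OF f p] moderateD(4)[OF g p]]]
    by (auto simp: poly_growth_def)
  show "((\<lambda>q. B (f q y) (g q y)) has_derivative (\<lambda>h. B (f p y) (g' p y h) + B (f' p y h) (g p y))) (at p)"
    by (intro bounded_bilinear.FDERIV[OF B] moderateD(3)[OF f p] moderateD(3)[OF g p])
  obtain C m where C: "C \<ge> 0" "\<forall>\<^sub>F q in nhds p. \<forall>y. norm (f q y) \<le> C * (1 + norm y) ^ m \<and>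
        (\<forall>h. norm (f' q y h) \<le> C * (1 + norm y) ^ m * norm h)"
    using moderateE[OF f p] by blast
  obtain D n where D: "D \<ge> 0" "\<forall>\<^sub>F q in nhds p. \<forall>y. norm (g q y) \<le> D * (1 + norm y) ^ n \<and>
        (\<forall>h. norm (g' q y h) \<le> D * (1 + norm y) ^ n * norm h)"
    using moderateE[OF g p] by blast
  obtain K where K: "K \<ge> 0" "\<And>a b. norm (B a b) \<le> norm a * norm b * K"
    using bounded_bilinear.nonneg_bounded[OF B] by auto
  show "\<exists>C\<ge>0. \<exists>n. \<forall>\<^sub>F q in nhds p. \<forall>y. norm (B (f q y) (g q y)) \<le> C * (1 + norm y) ^ n \<and>
        (\<forall>h. norm (B (f q y) (g' q y h) + B (f' q y h) (g q y)) \<le> C * (1 + norm y) ^ n * norm h)"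
  \<comment> \<open>The factor 2 accounts for the two terms of the product rule, \<open>K\<close>
    for the norm of the bilinear map.\<close>
  proof (intro exI[of _ "2 * K * C * D"] conjI exI[of _ "m + n"] eventually_mono[OF eventually_conj[OF C(2) D(2)]] allI)
    show "2 * K * C * D \<ge> 0" using C D K by simp
    fix q y h
    assume a: "(\<forall>y. norm (f q y) \<le> C * (1 + norm y) ^ m \<and>
        (\<forall>h. norm (f' q y h) \<le> C * (1 + norm y) ^ m * norm h)) \<and>
       (\<forall>y. norm (g q y) \<le> D * (1 + norm y) ^ n \<and>
        (\<forall>h. norm (g' q y h) \<le> D * (1 + norm y) ^ n * norm h))"
    have 1: "norm (f' q y h) \<le> (C * norm h) * (1 + norm y) ^ m"
      "norm (g' q y h) \<le> (D * norm h) * (1 + norm y) ^ n" using a by (simp_all add: mult_ac del: split_paired_All)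
    have 0: "norm (B u v) \<le> K * (C' * D') * (1 + norm y) ^ (m + n)"
      if "norm u \<le> C' * (1 + norm y) ^ m" "norm v \<le> D' * (1 + norm y) ^ n" "C' \<ge> 0" "D' \<ge> 0"
      for u v C' D'
    proof -
      have "norm u * norm v \<le> (C' * D') * (1 + norm y) ^ (m + n)"
        by (rule pow_bound_mult) (use that in auto)
      from mult_left_mono[OF this K(1)] show ?thesis
        by (intro order_trans[OF K(2)]) (simp add: mult_ac)
    qed
    have "norm (B (f q y) (g q y)) \<le> K * (C * D) * (1 + norm y) ^ (m + n)"
      by (rule 0) (use a C D in auto)
    moreover have "0 \<le> K * (C * D) * (1 + norm y) ^ (m + n)" using C D K by simp
    ultimately show "norm (B (f q y) (g q y)) \<le> 2 * K * C * D * (1 + norm y) ^ (m + n)"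
      by (simp add: mult_ac)
    have "norm (B (f q y) (g' q y h)) \<le> K * (C * (D * norm h)) * (1 + norm y) ^ (m + n)"
      "norm (B (f' q y h) (g q y)) \<le> K * ((C * norm h) * D) * (1 + norm y) ^ (m + n)"
      by (rule 0; use a C D 1 in auto)+
    then show "norm (B (f q y) (g' q y h) + B (f' q y h) (g q y))
        \<le> 2 * K * C * D * (1 + norm y) ^ (m + n) * norm h"
      by (intro order_trans[OF norm_triangle_ineq]) (simp add: algebra_simps)
  qed
qed

text \<open>For a function of the parameter alone, continuity already bounds the values near p; only
  the derivative needs a local bound, and the growth exponent is 0.\<close>

lemma moderate_param:
  fixes u :: "real \<times> 'a::euclidean_space \<Rightarrow> 'b::euclidean_space"
  assumes "\<And>p. fst p > 0 \<Longrightarrow> (u has_derivative u' p) (at p)"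
    and "\<And>p. fst p > 0 \<Longrightarrow> \<exists>C. \<forall>\<^sub>F q in nhds p. \<forall>h. norm (u' q h) \<le> C * norm h"
  shows "moderate (\<lambda>p y. u p) (\<lambda>p y. u' p)"
  unfolding moderate_def
proof (intro allI impI conjI)
  fix p :: "real \<times> 'a" and y :: 'a and h :: "real \<times> 'a" assume p: "fst p > 0"
  show "((\<lambda>q. u q) has_derivative u' p) (at p)" using assms(1)[OF p] by simp
  then have "isCont u p" by (rule has_derivative_continuous)
  then have 1: "\<forall>\<^sub>F q in nhds p. norm (u q) \<le> norm (u p) + 1"
    by (rule eventually_nhds_norm_le)
  obtain C where C: "\<forall>\<^sub>F q in nhds p. \<forall>h. norm (u' q h) \<le> C * norm h"
    using assms(2)[OF p] by auto
  let ?C = "max C (norm (u p) + 1)"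
  show "\<exists>C\<ge>0. \<exists>n. \<forall>\<^sub>F q in nhds p. \<forall>y. norm (u q) \<le> C * (1 + norm (y::'a)) ^ n \<and>
        (\<forall>h. norm (u' q h) \<le> C * (1 + norm y) ^ n * norm h)"
  proof (intro exI[of _ ?C] conjI exI[of _ 0] eventually_mono[OF eventually_conj[OF 1 C]] allI)
    fix q h :: "real \<times> 'a" assume a: "norm (u q) \<le> norm (u p) + 1 \<and> (\<forall>h. norm (u' q h) \<le> C * norm h)"
    have "C * norm h \<le> ?C * norm h" by (intro mult_right_mono) auto
    then show "norm (u' q h) \<le> ?C * (1 + norm (y::'a)) ^ 0 * norm h" for y
      using order_trans[OF spec[OF conjunct2[OF a], of h]] by simp
  qed (auto simp: le_max_iff_disj)
qed auto

lemma moderate_snd: "moderate (\<lambda>p y. snd p) (\<lambda>p y h. snd h)"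
proof (rule moderate_param)
  show "\<exists>C. \<forall>\<^sub>F q in nhds p. \<forall>h. norm (snd h :: 'a) \<le> C * norm (h :: real \<times> 'a)" for p :: "real \<times> 'a"
    by (rule exI[of _ 1]) (auto simp: norm_snd_le)
qed (auto intro!: derivative_eq_intros)

lemma moderate_const: "moderate (\<lambda>p y. c) (\<lambda>p y h. 0)"
  by (rule moderate_param) (auto intro!: exI[of _ 0])

lemma moderate_id: "moderate (\<lambda>p y. y) (\<lambda>p y h. 0)"
  unfolding moderate_def
  by (auto intro!: exI[of _ 1])

lemma moderate_coeff:
  assumes "c \<in> smooth_coeffs"
  shows "moderate (\<lambda>p y. c (fst p)) (\<lambda>p y h. deriv c (fst p) * fst h)"
proof (rule moderate_param)
  fix p :: "real \<times> 'a" assume p: "fst p > 0"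
  show "((\<lambda>p. c (fst p)) has_derivative (\<lambda>h. deriv c (fst p) * fst h)) (at p)"
    using has_derivative_compose[OF has_derivative_fst[OF has_derivative_ident]
        smooth_coeffs_deriv(2)[OF assms p, unfolded has_field_derivative_def]] by simp
  \<comment> \<open>The derivative of a smooth coefficient is smooth, hence continuous, hence
    locally bounded.\<close>
  have "isCont (deriv c) (fst p)"
    using smooth_coeffs_deriv(2)[OF smooth_coeffs_deriv(1)[OF assms] p] DERIV_isCont by blast
  then have "isCont (\<lambda>q. deriv c (fst q)) p"
    by (intro continuous_at_compose[of _ fst "deriv c", unfolded o_def] continuous_fst continuous_ident) simp
  then have "\<forall>\<^sub>F q in nhds p. norm (deriv c (fst q)) \<le> norm (deriv c (fst p)) + 1"
    by (rule eventually_nhds_norm_le)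
  moreover have "\<bar>fst h\<bar> \<le> norm h" for h :: "real \<times> 'a"
    using norm_fst_le[of "fst h" "snd h"] by simp
  ultimately show "\<exists>C. \<forall>\<^sub>F q in nhds p. \<forall>h :: real \<times> 'a. norm (deriv c (fst q) * fst h) \<le> C * norm h"
    by (intro exI[of _ "norm (deriv c (fst p)) + 1"])
       (auto elim!: eventually_mono simp: abs_mult simp del: split_paired_All intro!: mult_mono)
qed

text \<open>By continuity N stays above half of its positive value near p, which bounds the
  reciprocal and its derivative locally. This is applied to the normalizing constant.\<close>

lemma moderate_inverse:
  fixes N :: "real \<times> 'a::euclidean_space \<Rightarrow> real"
  assumes N: "moderate (\<lambda>p y. N p) (\<lambda>p y. N' p)" and pos: "\<And>p. fst p > 0 \<Longrightarrow> N p > 0"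
  shows "moderate (\<lambda>p y. inverse (N p)) (\<lambda>p y h. - (inverse (N p) * N' p h * inverse (N p)))"
proof (rule moderate_param)
  fix p :: "real \<times> 'a" assume p: "fst p > 0"
  have d: "(N has_derivative N' p) (at p)" using moderateD(3)[OF N p] by simp
  then show "((\<lambda>p. inverse (N p)) has_derivative (\<lambda>h. - (inverse (N p) * N' p h * inverse (N p)))) (at p)"
    using pos[OF p] by (intro Deriv.has_derivative_inverse) auto
  have "isCont N p" using d by (rule has_derivative_continuous)
  then have 1: "\<forall>\<^sub>F q in nhds p. N q > N p / 2"
    using pos[OF p] by (intro order_tendstoD(1)[OF isCont_tendsto_nhds]) auto
  obtain C n where C: "C \<ge> 0" "\<forall>\<^sub>F q in nhds p. \<forall>y::'a. norm (N q) \<le> C * (1 + norm y) ^ n \<and>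
        (\<forall>h. norm (N' q h) \<le> C * (1 + norm y) ^ n * norm h)"
    using moderateE[OF N p] by blast
  show "\<exists>C. \<forall>\<^sub>F q in nhds p. \<forall>h. norm (- (inverse (N q) * N' q h * inverse (N q))) \<le> C * norm h"
  proof (intro exI[of _ "2 / N p * C * (2 / N p)"] eventually_mono[OF eventually_conj[OF 1 C(2)]] allI)
    fix q h
    assume a: "N q > N p / 2 \<and> (\<forall>y::'a. norm (N q) \<le> C * (1 + norm y) ^ n \<and>
        (\<forall>h. norm (N' q h) \<le> C * (1 + norm y) ^ n * norm h))"
    have i: "\<bar>inverse (N q)\<bar> \<le> 2 / N p"
    proof -
      have "inverse (N q) \<le> inverse (N p / 2)" using a pos[OF p] by (intro le_imp_inverse_le) auto
      moreover have "N q > 0" using a pos[OF p] by auto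
      ultimately show ?thesis by simp
    qed
    \<comment> \<open>At y = 0 the polynomial factor equals 1.\<close>
    have "\<bar>N' q h\<bar> \<le> C * norm h" using spec[OF conjunct2[OF a], of 0] by (simp del: split_paired_All)
    then have "\<bar>inverse (N q)\<bar> * \<bar>N' q h\<bar> * \<bar>inverse (N q)\<bar> \<le> 2 / N p * (C * norm h) * (2 / N p)"
      using i C pos[OF p] by (intro mult_mono) auto
    then show "norm (- (inverse (N q) * N' q h * inverse (N q))) \<le> 2 / N p * C * (2 / N p) * norm h"
      by (simp add: abs_mult mult_ac)
  qed
qed

subsection \<open>Differentiation under the integral\<close>

definition log_weight :: "real \<times> 'a::euclidean_space \<Rightarrow> 'a \<Rightarrow> real" where
  "log_weight p y = (score_shift (fst p) - 1) / 2 * (snd p \<bullet> snd p)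
     + score_gain (fst p) * (snd p \<bullet> y) + score_shift (fst p) / 2 * (y \<bullet> y)"

text \<open>The joint derivative of \<open>log_weight\<close> at positive times, with a' =
  \<open>\<lambda>^2\<close> and \<lambda>' = \<lambda> (a - 1/2) already substituted;
  \<open>fst h\<close> carries the time part and \<open>snd h\<close> the space part.\<close>

definition log_weight' :: "real \<times> 'a::euclidean_space \<Rightarrow> 'a \<Rightarrow> real \<times> 'a \<Rightarrow> real" where
  "log_weight' p y h =
     fst h * ((score_gain (fst p))\<^sup>2 / 2 * (snd p \<bullet> snd p)
       + score_gain (fst p) * (score_shift (fst p) - 1 / 2) * (snd p \<bullet> y)
       + (score_gain (fst p))\<^sup>2 / 2 * (y \<bullet> y))
     + ((score_shift (fst p) - 1) * (snd p \<bullet> snd h) + score_gain (fst p) * (snd h \<bullet> y))"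

abbreviation weight :: "real \<times> 'a::euclidean_space \<Rightarrow> 'a \<Rightarrow> real" where
  "weight p y \<equiv> exp (log_weight p y)"

lemma weight_eq: "t > 0 \<Longrightarrow> posterior_weight t x y = weight (t, x) y"
  by (simp add: posterior_weight_eq log_weight_def field_simps)

lemmas moderate_inner = moderate_bilinear[OF bounded_bilinear_inner]
lemmas moderate_mult = moderate_bilinear[OF bounded_bilinear_mult]
lemmas moderate_scaleR = moderate_bilinear[OF bounded_bilinear_scaleR]

lemma moderate_log_weight: "moderate log_weight log_weight'"
proof -
  have S: "(\<lambda>t. (score_shift t + (- 1)) * (1 / 2)) \<in> smooth_coeffs" "(\<lambda>t. score_shift t * (1 / 2)) \<in> smooth_coeffs"
    by (intro smooth_coeffs_intros)+
  \<comment> \<open>The calculus rules give moderateness with an unsimplified Leibniz derivative;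
    the congruence rule then replaces it by the closed formula.\<close>
  note m = moderate_add[OF moderate_add[OF
      moderate_mult[OF moderate_coeff[OF S(1)] moderate_inner[OF moderate_snd moderate_snd]]
      moderate_mult[OF moderate_coeff[OF smooth_coeffs_intros(3)] moderate_inner[OF moderate_snd moderate_id]]]
      moderate_mult[OF moderate_coeff[OF S(2)] moderate_inner[OF moderate_id moderate_id]]]
  show ?thesis
  proof (rule moderate_cong[OF m])
    fix p :: "real \<times> 'a" and y h assume p: "fst p > 0"
    show "log_weight p y = (score_shift (fst p) + - 1) * (1 / 2) * (snd p \<bullet> snd p) +
           score_gain (fst p) * (snd p \<bullet> y) + score_shift (fst p) * (1 / 2) * (y \<bullet> y)"
      by (simp add: log_weight_def)
    have "((\<lambda>t. (score_shift t + (- 1)) * (1 / 2)) has_real_derivative (score_gain (fst p))\<^sup>2 / 2) (at (fst p))"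
      "((\<lambda>t. score_shift t * (1 / 2)) has_real_derivative (score_gain (fst p))\<^sup>2 / 2) (at (fst p))"
      by (rule derivative_eq_intros refl score_shift_deriv[OF p] | simp)+
    then have d: "deriv (\<lambda>t. (score_shift t + (- 1)) * (1 / 2)) (fst p) = (score_gain (fst p))\<^sup>2 / 2"
      "deriv (\<lambda>t. score_shift t * (1 / 2)) (fst p) = (score_gain (fst p))\<^sup>2 / 2"
      "deriv score_gain (fst p) = score_gain (fst p) * (score_shift (fst p) - 1 / 2)"
      using score_gain_deriv[OF p] by (blast intro: DERIV_imp_deriv)+
    show "log_weight' p y h = 
      (score_shift (fst p) + - 1) * (1 / 2) * (snd p \<bullet> snd h + snd h \<bullet> snd p) +
      deriv (\<lambda>t. (score_shift t + - 1) * (1 / 2)) (fst p) * fst h * (snd p \<bullet> snd p) +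
      (score_gain (fst p) * (snd p \<bullet> 0 + snd h \<bullet> y) + deriv score_gain (fst p) * fst h * (snd p \<bullet> y)) +
      (score_shift (fst p) * (1 / 2) * (y \<bullet> 0 + 0 \<bullet> y) +
       deriv (\<lambda>t. score_shift t * (1 / 2)) (fst p) * fst h * (y \<bullet> y))"
      unfolding log_weight'_def d by (simp add: inner_commute field_simps)
  qed
qed

section \<open>Gaussian decay of the posterior weight\<close>

lemma power_le_fact_exp:
  fixes u :: real
  assumes "u \<ge> 0"
  shows "u ^ n \<le> fact n * exp u"
proof -
  \<comment> \<open>The n-th term of the exponential series is at most the whole series.\<close>
  have "(\<Sum>k\<in>{n}. u ^ k /\<^sub>R fact k) \<le> (\<Sum>k. u ^ k /\<^sub>R fact k)"
    using assms by (intro sum_le_suminf summable_exp_generic) auto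
  then show ?thesis by (simp add: exp_def field_simps)
qed

lemma quadratic_le_vertex:
  fixes K c r :: real
  assumes "c > 0"
  shows "K * r - c * r\<^sup>2 \<le> K\<^sup>2 / (4 * c)"
proof -
  have "0 \<le> (2 * c * r - K)\<^sup>2" by simp
  then have "(K * r - c * r\<^sup>2) * (4 * c) \<le> K\<^sup>2"
    by (simp add: power2_eq_square algebra_simps)
  then show ?thesis using assms by (simp add: pos_le_divide_eq)
qed

text \<open>Near p the negative coefficient of the inner product of y with itself stays bounded away
  from 0, while \<lambda> |x| stays bounded. The power is absorbed into an exponential of
  \<open>1 + norm y\<close>, and what remains is a concave quadratic in \<open>norm y\<close>,
  bounded by its vertex value.\<close>

lemma weight_bound:
  fixes p :: "real \<times> 'a::euclidean_space"
  assumes p: "fst p > 0"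
  shows "\<exists>C. \<forall>\<^sub>F q in nhds p. \<forall>y. weight q y * (1 + norm y) ^ n \<le> C"
proof -
  let ?s = "score_shift (fst p)" and ?g = "\<lambda>q. score_gain (fst q) * norm (snd q)"
  have neg: "score_shift t < 0" if "t > 0" for t using that by (simp add: score_shift_def)
  have gpos: "score_gain t > 0" if "t > 0" for t using that by (simp add: score_gain_def)
  have "isCont score_shift (fst p)" "isCont score_gain (fst p)"
    using score_shift_deriv[OF p] score_gain_deriv[OF p] by (auto intro: DERIV_isCont)
  then have cont: "isCont (\<lambda>q. score_shift (fst q)) p" "isCont ?g p"
    by (auto intro!: continuous_intros continuous_at_compose[of _ fst, unfolded o_def])
  have 1: "\<forall>\<^sub>F q in nhds p. score_shift (fst q) < ?s / 2"
    using neg[OF p] by (intro order_tendstoD(2)[OF isCont_tendsto_nhds[OF cont(1)]]) auto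
  have 2: "\<forall>\<^sub>F q in nhds p. norm (?g q) \<le> norm (?g p) + 1"
    by (rule eventually_nhds_norm_le[OF cont(2)])
  \<comment> \<open>In \<open>?K\<close> one unit allows for the local variation of
    \<open>?g\<close> and the other absorbs the exponential of \<open>norm y\<close>. The value of
    \<open>?c\<close> results from halving a(t) for local variation and once more for the factor 1/2
    in the exponent.\<close>
  let ?K = "norm (?g p) + 2" and ?c = "- ?s / 4"
  have c: "?c > 0" using neg[OF p] by simp
  have "weight q y * (1 + norm y) ^ n \<le> fact n * exp (1 + ?K\<^sup>2 / (4 * ?c))"
    if q: "fst q > 0" "score_shift (fst q) < ?s / 2" "norm (?g q) \<le> norm (?g p) + 1" for q and y :: 'a
  proof -
    have "log_weight q y \<le> ?g q * norm y - ?c * (norm y)\<^sup>2"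
    proof -
      have 1: "(score_shift (fst q) - 1) / 2 * (snd q \<bullet> snd q) \<le> 0"
        using neg[OF q(1)] by (intro mult_nonpos_nonneg) auto
      have 2: "score_gain (fst q) * (snd q \<bullet> y) \<le> ?g q * norm y"
        using gpos[OF q(1)] by (simp add: mult.assoc norm_cauchy_schwarz)
      have 3: "score_shift (fst q) / 2 * (y \<bullet> y) \<le> (- ?c) * (y \<bullet> y)"
        using q(2) by (intro mult_right_mono) auto
      from add_mono[OF add_mono[OF 1 2] 3] show ?thesis by (simp add: log_weight_def power2_norm_eq_inner)
    qed
    moreover have "?g q * norm y \<le> ?K * norm y - norm y"
    proof -
      have "?g q * norm y \<le> (?K - 1) * norm y" using q(3) by (intro mult_right_mono) auto
      then show ?thesis by (simp only: left_diff_distrib mult_1_left)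
    qed
    moreover have "?K * norm y - ?c * (norm y)\<^sup>2 \<le> ?K\<^sup>2 / (4 * ?c)"
      by (rule quadratic_le_vertex[OF c])
    ultimately have le: "log_weight q y + (1 + norm y) \<le> 1 + ?K\<^sup>2 / (4 * ?c)" by linarith
    have "weight q y * (1 + norm y) ^ n \<le> weight q y * (fact n * exp (1 + norm y))"
      by (intro mult_left_mono power_le_fact_exp) auto
    also have "\<dots> = fact n * exp (log_weight q y + (1 + norm y))"
      by (simp add: exp_add)
    also have "\<dots> \<le> fact n * exp (1 + ?K\<^sup>2 / (4 * ?c))"
      by (rule mult_left_mono) (simp_all only: exp_le_cancel_iff le fact_ge_zero)
    finally show ?thesis .
  qed
  then show ?thesis
    by (intro exI[of _ "fact n * exp (1 + ?K\<^sup>2 / (4 * ?c))"]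
        eventually_mono[OF eventually_conj[OF eventually_nhds_pos[OF p] eventually_conj[OF 1 2]]]) blast
qed

text \<open>Supplies the uniform bounds needed to differentiate under the integral: differentiating
  the exponential produces the term with \<open>log_weight'\<close>, whose polynomial growth the
  weight absorbs as well.\<close>

lemma weight_integrand_bound:
  fixes p :: "real \<times> 'a::euclidean_space"
    and g :: "real \<times> 'a \<Rightarrow> 'a \<Rightarrow> 'b::euclidean_space"
  assumes g: "moderate g g'" and p: "fst p > 0"
  shows "\<exists>C. \<forall>\<^sub>F q in nhds p. \<forall>y. norm (weight q y *\<^sub>R g q y) \<le> C \<and>
    (\<forall>h. norm (weight q y *\<^sub>R (log_weight' q y h *\<^sub>R g q y + g' q y h)) \<le> C * norm h)"
proof -
  obtain C n where C: "C \<ge> 0" "\<forall>\<^sub>F q in nhds p. \<forall>y. norm (g q y) \<le> C * (1 + norm y) ^ n \<and>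
    (\<forall>h. norm (g' q y h) \<le> C * (1 + norm y) ^ n * norm h)" using moderateE[OF g p] by blast
  obtain D m where D: "D \<ge> 0" "\<forall>\<^sub>F q in nhds p. \<forall>y. norm (log_weight q y) \<le> D * (1 + norm y) ^ m \<and>
    (\<forall>h. norm (log_weight' q y h) \<le> D * (1 + norm y) ^ m * norm h)"
    using moderateE[OF moderate_log_weight p] by blast
  obtain W where W: "\<forall>\<^sub>F q in nhds p. \<forall>y. weight q y * (1 + norm y) ^ (m + n + n) \<le> W"
    using weight_bound[OF p] by blast
  show ?thesis
  \<comment> \<open>\<open>C\<close> covers g itself, while \<open>D * C\<close> and
    \<open>C\<close> cover the two terms of the derivative; the power \<open>m + n + n\<close>
    accommodates all of them.\<close>
  proof (intro exI[of _ "(C + D * C + C) * W"] eventually_mono[OF eventually_conj[OF C(2) eventually_conj[OF D(2) W]]] allI conjI)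
    fix q h :: "real \<times> 'a" and y :: 'a
    assume a: "(\<forall>y. norm (g q y) \<le> C * (1 + norm y) ^ n \<and>
      (\<forall>h. norm (g' q y h) \<le> C * (1 + norm y) ^ n * norm h)) \<and>
      (\<forall>y. norm (log_weight q y) \<le> D * (1 + norm y) ^ m \<and>
      (\<forall>h. norm (log_weight' q y h) \<le> D * (1 + norm y) ^ m * norm h)) \<and>
      (\<forall>y. weight q y * (1 + norm y) ^ (m + n + n) \<le> W)"
    let ?r = "1 + norm y"
    have b: "norm (g q y) \<le> C * ?r ^ n" "norm (g' q y h) \<le> (C * norm h) * ?r ^ n"
      "norm (log_weight' q y h) \<le> (D * norm h) * ?r ^ m" "weight q y * ?r ^ (m + n + n) \<le> W"
      using a by (simp_all add: mult_ac del: split_paired_All)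
    have fin: "norm (weight q y *\<^sub>R v) \<le> (C + D * C + C) * W * l"
      if v: "norm v \<le> (C + D * C + C) * l * ?r ^ (m + n + n)" and l: "l \<ge> 0" for v :: 'b and l
    proof -
      have "norm (weight q y *\<^sub>R v) \<le> weight q y * ((C + D * C + C) * l * ?r ^ (m + n + n))"
        using v by (simp add: mult_left_mono)
      also have "\<dots> = ((C + D * C + C) * l) * (weight q y * ?r ^ (m + n + n))" by (simp only: mult_ac)
      also have "\<dots> \<le> ((C + D * C + C) * l) * W"
        using b(4) C D l by (intro mult_left_mono) auto
      finally show ?thesis by (simp only: mult_ac)
    qed
    have mono: "?r ^ n \<le> ?r ^ (m + n + n)" by (intro power_increasing) auto
    have "norm (g q y) \<le> (C + D * C + C) * ?r ^ (m + n + n)"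
    proof -
      have "C * ?r ^ n \<le> (C + D * C + C) * ?r ^ (m + n + n)"
        using C D mono by (intro mult_mono) auto
      then show ?thesis using b(1) by simp
    qed
    then show "norm (weight q y *\<^sub>R g q y) \<le> (C + D * C + C) * W" using fin[of "g q y" 1] by simp
    have "norm (log_weight' q y h) * norm (g q y) \<le> ((D * norm h) * C) * ?r ^ (m + n)"
      by (rule pow_bound_mult) (use b C D in auto)
    then have "norm (log_weight' q y h *\<^sub>R g q y + g' q y h)
        \<le> ((D * norm h) * C + C * norm h) * ?r ^ (m + n + n)"
      by (intro order_trans[OF norm_triangle_ineq pow_bound_add]) (use b C D in auto)
    also have "\<dots> \<le> (C + D * C + C) * norm h * ?r ^ (m + n + n)"
      using C D by (intro mult_right_mono) (auto simp: algebra_simps)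
    finally show "norm (weight q y *\<^sub>R (log_weight' q y h *\<^sub>R g q y + g' q y h))
        \<le> (C + D * C + C) * W * norm h" by (rule fin) auto
  qed
qed

locale prior = prob_space P0 for P0 :: "'a::euclidean_space measure" +
  assumes sets_P0 [measurable_cong]: "sets P0 = sets borel"
begin

lemma measurable_prior: "f \<in> borel_measurable borel \<Longrightarrow> f \<in> borel_measurable P0"
  by measurable

lemma weight_measurable: "fst p > 0 \<Longrightarrow> weight p \<in> borel_measurable borel"
  using moderateD(1)[OF moderate_log_weight, of p] by measurable

text \<open>The weight times a polynomially growing function is bounded, and bounded measurable
  functions are integrable for a probability measure.\<close>

lemma integrable_weight:
  fixes f :: "'a \<Rightarrow> 'b::euclidean_space"
  assumes p: "fst p > 0" and f: "poly_growth f"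
  shows "integrable P0 (\<lambda>y. weight p y *\<^sub>R f y)"
proof -
  obtain C n where C: "C \<ge> 0" "\<And>y. norm (f y) \<le> C * (1 + norm y) ^ n"
    using f by (auto simp: poly_growth_def)
  obtain W where W: "\<And>y. weight p y * (1 + norm y) ^ n \<le> W"
    using weight_bound[OF p, of n] by (blast dest: eventually_nhds_x_imp_x)
  have [measurable]: "f \<in> borel_measurable P0" "weight p \<in> borel_measurable P0"
    using f weight_measurable[OF p] by (auto simp: poly_growth_def intro: measurable_prior)
  show ?thesis
  proof (rule integrable_const_bound[where B = "C * W"])
    show "AE y in P0. norm (weight p y *\<^sub>R f y) \<le> C * W"
    proof (rule AE_I2)
      fix y
      have "norm (weight p y *\<^sub>R f y) \<le> weight p y * (C * (1 + norm y) ^ n)"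
        using C by (simp add: mult_left_mono)
      also have "\<dots> = C * (weight p y * (1 + norm y) ^ n)" by (simp add: mult_ac)
      also have "\<dots> \<le> C * W" using W C by (intro mult_left_mono) auto
      finally show "norm (weight p y *\<^sub>R f y) \<le> C * W" .
    qed
  qed measurable
qed

text \<open>The weighted integral is again moderate, so averages may reappear inside later
  integrands; this is what makes nested insertions tractable.\<close>

lemma moderate_integral:
  fixes g :: "real \<times> 'a \<Rightarrow> 'a \<Rightarrow> 'b::euclidean_space"
  assumes g: "moderate g g'"
  shows "moderate (\<lambda>p y. \<integral>y. weight p y *\<^sub>R g p y \<partial>P0)
    (\<lambda>p y h. \<integral>y. weight p y *\<^sub>R (log_weight' p y h *\<^sub>R g p y + g' p y h) \<partial>P0)"
proof (rule moderate_param)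
  fix p :: "real \<times> 'a" assume p: "fst p > 0"
  let ?f' = "\<lambda>p y h. weight p y *\<^sub>R (log_weight' p y h *\<^sub>R g p y + g' p y h)"
  obtain C where C: "\<forall>\<^sub>F q in nhds p. \<forall>y. norm (weight q y *\<^sub>R g q y) \<le> C \<and>
    (\<forall>h. norm (?f' q y h) \<le> C * norm h)"
    using weight_integrand_bound[OF g p] by blast
  have pg: "poly_growth (g q)" "poly_growth (\<lambda>y. log_weight' q y h *\<^sub>R g q y + g' q y h)" if "fst q > 0" for q h
    using that by (intro moderateD[OF g] poly_growth_add poly_growth_scaleR moderateD[OF moderate_log_weight]; simp)+
  \<comment> \<open>One radius serves both purposes: on this ball times are positive and the uniform
    bounds hold.\<close>
  obtain e where e: "e > 0" "\<And>q. dist q p < e \<Longrightarrow> fst q > 0 \<and> (\<forall>y. norm (weight q y *\<^sub>R g q y) \<le> C \<and>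
    (\<forall>h. norm (?f' q y h) \<le> C * norm h))"
    using eventually_conj[OF eventually_nhds_pos[OF p] C] unfolding eventually_nhds_metric by blast
  show "((\<lambda>p. \<integral>y. weight p y *\<^sub>R g p y \<partial>P0) has_derivative (\<lambda>h. \<integral>y. ?f' p y h \<partial>P0)) (at p)"
  proof (rule has_derivative_integral_bounded[where e = e and C = C and f' = ?f'])
    show "finite_measure P0" by (rule finite_measure_axioms)
    show "(\<lambda>y. weight q y *\<^sub>R g q y) \<in> borel_measurable P0" if "q \<in> ball p e" for q
      using integrable_weight[OF _ pg(1)] e(2)[of q] that by (auto simp: dist_commute)
    show "(\<lambda>y. ?f' p y h) \<in> borel_measurable P0" for h
      using integrable_weight[OF p pg(2)[OF p]] by auto
    show "integrable P0 (\<lambda>y. weight p y *\<^sub>R g p y)" by (rule integrable_weight[OF p pg(1)[OF p]])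
    show "((\<lambda>q. weight q y *\<^sub>R g q y) has_derivative ?f' q y) (at q)" if "q \<in> ball p e" for q y
    proof -
      have q: "fst q > 0" using e(2)[of q] that by (auto simp: dist_commute)
      show ?thesis
        by (rule has_derivative_eq_rhs, rule has_derivative_scaleR[OF
            has_derivative_exp[OF moderateD(3)[OF moderate_log_weight q]] moderateD(3)[OF g q]])
           (auto simp: scaleR_add_right)
    qed
    show "norm (?f' q y h) \<le> C * norm h" if "q \<in> ball p e" for q y h
      using e(2)[of q] that by (auto simp: dist_commute simp del: split_paired_All)
  qed (use e in auto)
  show "\<exists>C. \<forall>\<^sub>F q in nhds p. \<forall>h. norm (\<integral>y. ?f' q y h \<partial>P0) \<le> C * norm h"
  proof (intro exI[of _ C] eventually_mono[OF eventually_conj[OF eventually_nhds_pos[OF p] C]] allI)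
    fix q h
    assume a: "fst q > 0 \<and> (\<forall>y. norm (weight q y *\<^sub>R g q y) \<le> C \<and> (\<forall>h. norm (?f' q y h) \<le> C * norm h))"
    have "norm (\<integral>y. ?f' q y h \<partial>P0) \<le> (\<integral>y. norm (?f' q y h) \<partial>P0)" by (rule integral_norm_bound)
    also have "\<dots> \<le> (\<integral>y. C * norm h \<partial>P0)"
      using a integrable_weight[of q, OF _ pg(2)] by (intro integral_mono integrable_norm) (auto simp del: split_paired_All)
    finally show "norm (\<integral>y. ?f' q y h \<partial>P0) \<le> C * norm h" by (simp add: prob_space)
  qed
qed

end

subsection \<open>Posterior averages and their material derivative\<close>

context prior
begin

definition normalizer :: "real \<times> 'a \<Rightarrow> real" where
  "normalizer p = (\<integral>y. weight p y \<partial>P0)"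

definition avg :: "real \<times> 'a \<Rightarrow> ('a \<Rightarrow> 'b::euclidean_space) \<Rightarrow> 'b" where
  "avg p f = (LINT y|posterior P0 (fst p) (snd p). f y)"

abbreviation ybar :: "real \<times> 'a \<Rightarrow> 'a" where
  "ybar p \<equiv> posterior_mean P0 (fst p) (snd p)"

text \<open>The weight is an exponential and never vanishes, whereas a zero integral would make it
  vanish almost everywhere.\<close>

lemma normalizer_pos:
  assumes p: "fst p > 0"
  shows "normalizer p > 0"
proof -
  have int: "integrable P0 (weight p)"
    using integrable_weight[OF p poly_growth_const[of "1::real"]] by simp
  have "normalizer p \<noteq> 0"
  proof
    assume "normalizer p = 0"
    then have "AE y in P0. weight p y = 0"
      using integral_nonneg_eq_0_iff_AE[OF int] by (simp add: normalizer_def)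
    then have "AE y in P0. False" by simp
    then show False by simp
  qed
  moreover have "normalizer p \<ge> 0" unfolding normalizer_def by (intro integral_nonneg_AE) auto
  ultimately show ?thesis by simp
qed

text \<open>Reduces posterior expectations to weighted integrals against the fixed measure
  \<open>P0\<close>, where the parameter enters only through the integrand and the
  normalizer.\<close>

lemma avg_eq:
  assumes p: "fst p > 0" and f: "poly_growth f"
  shows "avg p f = inverse (normalizer p) *\<^sub>R (\<integral>y. weight p y *\<^sub>R f y \<partial>P0)"
proof -
  have [measurable]: "f \<in> borel_measurable P0" "weight p \<in> borel_measurable P0"
    using f weight_measurable[OF p] by (auto simp: poly_growth_def intro: measurable_prior)
  have "posterior P0 (fst p) (snd p) = density P0 (\<lambda>y. ennreal (weight p y / normalizer p))"
    using p by (simp add: posterior_def normalizer_def weight_eq)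
  then have "avg p f = (\<integral>y. (weight p y / normalizer p) *\<^sub>R f y \<partial>P0)"
    using normalizer_pos[OF p] by (simp add: avg_def integral_density)
  also have "\<dots> = (\<integral>y. inverse (normalizer p) *\<^sub>R (weight p y *\<^sub>R f y) \<partial>P0)"
    by (simp add: divide_inverse mult_ac)
  finally show ?thesis by (simp only: integral_scaleR_right)
qed

lemma avg_add:
  fixes f g :: "'a \<Rightarrow> 'b::euclidean_space"
  assumes p: "fst p > 0" and f: "poly_growth f" and g: "poly_growth g"
  shows "avg p (\<lambda>y. f y + g y) = avg p f + avg p g"
  using integrable_weight[OF p f] integrable_weight[OF p g]
  by (simp add: avg_eq[OF p] f g poly_growth_add scaleR_add_right)

lemma avg_linear:
  fixes f :: "'a \<Rightarrow> 'b::euclidean_space" and T :: "'b \<Rightarrow> 'c::euclidean_space"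
  assumes p: "fst p > 0" and f: "poly_growth f" and T: "bounded_linear T"
  shows "avg p (\<lambda>y. T (f y)) = T (avg p f)"
proof -
  obtain K where K: "K \<ge> 0" "\<And>v. norm (T v) \<le> norm v * K"
    using bounded_linear.nonneg_bounded[OF T] by blast
  obtain C n where C: "C \<ge> 0" "\<And>y. norm (f y) \<le> C * (1 + norm y) ^ n"
    using f by (auto simp: poly_growth_def)
  have "poly_growth (\<lambda>y. T (f y))"
  proof (rule poly_growthI)
    show "(\<lambda>y. T (f y)) \<in> borel_measurable borel"
      using f bounded_linear.continuous_on[OF T continuous_on_id]
      by (auto simp: poly_growth_def intro: borel_measurable_continuous_on)
    show "norm (T (f y)) \<le> (C * K) * (1 + norm y) ^ n" for y
      using order_trans[OF K(2) mult_right_mono[OF C(2) K(1)]] by (simp add: mult_ac)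
  qed
  then have "avg p (\<lambda>y. T (f y)) = inverse (normalizer p) *\<^sub>R (\<integral>y. T (weight p y *\<^sub>R f y) \<partial>P0)"
    by (simp add: avg_eq[OF p] linear_simps[OF T])
  also have "(\<integral>y. T (weight p y *\<^sub>R f y) \<partial>P0) = T (\<integral>y. weight p y *\<^sub>R f y \<partial>P0)"
    by (rule integral_bounded_linear[OF T integrable_weight[OF p f]])
  finally show ?thesis by (simp add: avg_eq[OF p f] linear_simps[OF T])
qed

lemma avg_const: "fst p > 0 \<Longrightarrow> avg p (\<lambda>y. c) = c"
proof -
  assume p: "fst p > 0"
  have "(\<integral>y. weight p y *\<^sub>R c \<partial>P0) = normalizer p *\<^sub>R c"
    using integrable_weight[OF p poly_growth_const[of "1::real"]] by (simp add: normalizer_def)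
  then show ?thesis using normalizer_pos[OF p] by (simp add: avg_eq[OF p poly_growth_const])
qed

lemma ybar_eq: "ybar p = avg p (\<lambda>y. y)"
  by (simp add: avg_def posterior_mean_def)

lemma moderate_normalizer:
  "moderate (\<lambda>p y. normalizer p) (\<lambda>p y h. \<integral>y. weight p y *\<^sub>R log_weight' p y h \<partial>P0)"
  by (rule moderate_cong[OF moderate_integral[OF moderate_const[of "1::real"]]])
     (auto simp: normalizer_def)

text \<open>The quotient rule for the weighted integral over the normalizer: the change of the
  posterior enters as the covariance of the log-weight derivative with the integrand.\<close>

lemma moderate_avg:
  assumes g: "moderate g g'"
  shows "moderate (\<lambda>p y. avg p (g p)) (\<lambda>p y h. avg p (\<lambda>y. log_weight' p y h *\<^sub>R g p y + g' p y h)
    - avg p (\<lambda>y. log_weight' p y h) *\<^sub>R avg p (g p))"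
proof (rule moderate_cong[OF moderate_scaleR[OF
      moderate_inverse[OF moderate_normalizer normalizer_pos] moderate_integral[OF g]]])
  fix p :: "real \<times> 'a" and y h assume p: "fst p > 0"
  note pg = moderateD(4)[OF g p] moderateD(5)[OF g p] moderateD(5)[OF moderate_log_weight p]
  show "avg p (g p) = inverse (normalizer p) *\<^sub>R (\<integral>y. weight p y *\<^sub>R g p y \<partial>P0)"
    by (rule avg_eq[OF p pg(1)])
  show "avg p (\<lambda>y. log_weight' p y h *\<^sub>R g p y + g' p y h)
    - avg p (\<lambda>y. log_weight' p y h) *\<^sub>R avg p (g p) =
    inverse (normalizer p) *\<^sub>R (\<integral>y. weight p y *\<^sub>R (log_weight' p y h *\<^sub>R g p y + g' p y h) \<partial>P0)
    + - (inverse (normalizer p) * (\<integral>y. weight p y *\<^sub>R log_weight' p y h \<partial>P0)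
        * inverse (normalizer p)) *\<^sub>R (\<integral>y. weight p y *\<^sub>R g p y \<partial>P0)"
    by (simp add: avg_eq[OF p] pg poly_growth_add poly_growth_scaleR mult_ac)
qed (auto intro: normalizer_pos)

text \<open>Tweedie's formula. The forward density is the normalizer up to a factor free of x, so
  the gradient of its logarithm is the posterior mean of the x-gradient (a - 1) x + \<lambda> y of
  the log-weight.\<close>

lemma modified_score_eq:
  assumes t: "t > 0"
  shows "modified_score P0 t x = score_shift t *\<^sub>R x + score_gain t *\<^sub>R posterior_mean P0 t x"
proof -
  let ?p = "(t, x)"
  define c where "c = sqrt (2 * pi * (1 - exp (- t))) ^ DIM('a)"
  define G where "G = (score_shift t - 1) *\<^sub>R x + score_gain t *\<^sub>R posterior_mean P0 t x"
  have c: "c > 0" using t by (simp add: c_def)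
  have dens: "forward_density P0 t \<xi> = normalizer (t, \<xi>) * inverse c" for \<xi>
    using t by (simp add: forward_density_def normalizer_def c_def weight_eq divide_inverse)
  have p: "fst ?p > 0" using t by simp
  have pos: "normalizer (t, x) > 0" using normalizer_pos[OF p] .
  \<comment> \<open>The spatial derivative is the joint one restricted to increments with zero time
    component.\<close>
  have pair: "((\<lambda>\<xi>. (t, \<xi>)) has_derivative (\<lambda>h. (0, h))) (at x)"
    by (auto intro!: derivative_eq_intros)
  have "(normalizer has_derivative (\<lambda>h. \<integral>y. weight ?p y *\<^sub>R log_weight' ?p y h \<partial>P0)) (at (t, x))"
    using moderateD(3)[OF moderate_normalizer p] .
  from has_derivative_compose[OF pair this]
  have dN: "((\<lambda>\<xi>. normalizer (t, \<xi>)) has_derivative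
      (\<lambda>h. \<integral>y. weight ?p y *\<^sub>R log_weight' ?p y (0, h) \<partial>P0)) (at x)" .
  have "(\<integral>y. weight ?p y *\<^sub>R log_weight' ?p y (0, h) \<partial>P0) = normalizer ?p * (G \<bullet> h)" for h
  proof -
    have 1: "poly_growth (\<lambda>y::'a. (score_shift t - 1) * (x \<bullet> h))"
      "poly_growth (\<lambda>y::'a. (score_gain t *\<^sub>R h) \<bullet> y)"
      by (intro poly_growth_const poly_growth_inner poly_growth_id)+
    have "inverse (normalizer ?p) *\<^sub>R (\<integral>y. weight ?p y *\<^sub>R log_weight' ?p y (0, h) \<partial>P0)
        = avg ?p (\<lambda>y. log_weight' ?p y (0, h))"
      by (rule avg_eq[OF p moderateD(5)[OF moderate_log_weight p], symmetric])
    also have "\<dots> = avg ?p (\<lambda>y. (score_shift t - 1) * (x \<bullet> h) + (score_gain t *\<^sub>R h) \<bullet> y)"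
      by (simp add: log_weight'_def)
    also have "\<dots> = (score_shift t - 1) * (x \<bullet> h) + (score_gain t *\<^sub>R h) \<bullet> avg ?p (\<lambda>y. y)"
      by (simp only: avg_add[OF p 1] avg_const[OF p] avg_linear[OF p poly_growth_id bounded_linear_inner_right])
    also have "\<dots> = G \<bullet> h"
      using ybar_eq[of ?p] by (simp add: G_def inner_commute inner_add_left algebra_simps)
    finally show ?thesis using pos by (simp add: field_simps)
  qed
  with dN have dN: "((\<lambda>\<xi>. normalizer (t, \<xi>)) has_derivative (\<lambda>h. normalizer ?p * (G \<bullet> h))) (at x)" by simp
  have dl: "((\<lambda>\<xi>. ln (forward_density P0 t \<xi>)) has_derivative (\<lambda>h. h \<bullet> G)) (at x)"
    unfolding dens
    by (rule has_derivative_eq_rhs, rule has_derivative_ln[OF _ has_derivative_mult_left[OF dN]])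
       (use pos c in \<open>auto simp: field_simps inner_commute power2_eq_square\<close>)
  \<comment> \<open>Uniqueness of the derivative identifies the vector chosen by the definite
    description.\<close>
  have "(THE g. GDERIV (\<lambda>\<xi>. ln (forward_density P0 t \<xi>)) x :> g) = G"
  proof (rule the_equality)
    show "GDERIV (\<lambda>\<xi>. ln (forward_density P0 t \<xi>)) x :> G" using dl by (simp add: gderiv_def)
    fix g assume "GDERIV (\<lambda>\<xi>. ln (forward_density P0 t \<xi>)) x :> g"
    then have "(\<lambda>h. h \<bullet> g) = (\<lambda>h. h \<bullet> G)"
      using has_derivative_unique[OF _ dl] by (auto simp: gderiv_def)
    then show "g = G" by (metis vector_eq_ldot)
  qed
  then show ?thesis by (simp add: modified_score_def G_def algebra_simps)
qed

section \<open>Derivatives along the velocity of the material derivative\<close>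

definition velocity :: "real \<times> 'a \<Rightarrow> real \<times> 'a" where
  "velocity p = (- 1, (1 / 2) *\<^sub>R modified_score P0 (fst p) (snd p))"

text \<open>The operator L for y-dependent integrands: y is frozen and the joint derivative in (t,x)
  is taken along the velocity. Keeping only the value \<open>l\<close> along this direction gives a
  calculus in which the full derivative no longer appears.\<close>

definition transported ::
    "(real \<times> 'a \<Rightarrow> 'a \<Rightarrow> 'b::euclidean_space) \<Rightarrow> (real \<times> 'a \<Rightarrow> 'a \<Rightarrow> 'b) \<Rightarrow> bool" where
  "transported g l \<longleftrightarrow>
     (\<exists>g'. moderate g g' \<and> (\<forall>p y. fst p > 0 \<longrightarrow> l p y = g' p y (velocity p)))"

lemma transportedI:
  "moderate g g' \<Longrightarrow> (\<And>p y. fst p > 0 \<Longrightarrow> l p y = g' p y (velocity p)) \<Longrightarrow> transported g l"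
  unfolding transported_def by blast

lemma transportedE:
  assumes "transported g l"
  obtains g' where "moderate g g'" "\<And>p y. fst p > 0 \<Longrightarrow> l p y = g' p y (velocity p)"
  using assms unfolding transported_def by blast

lemma transported_growth:
  assumes "transported g l" "fst p > 0"
  shows "poly_growth (g p)" "poly_growth (l p)"
proof -
  obtain g' where g': "moderate g g'" "\<And>p y. fst p > 0 \<Longrightarrow> l p y = g' p y (velocity p)"
    using transportedE[OF assms(1)] by blast
  have "l p = (\<lambda>y. g' p y (velocity p))" using g'(2)[OF assms(2)] by (rule ext)
  then show "poly_growth (g p)" "poly_growth (l p)" using moderateD(4,5)[OF g'(1) assms(2)] by auto
qed

lemma transported_cong:
  assumes "transported g l" "\<And>p y. fst p > 0 \<Longrightarrow> f p y = g p y" "\<And>p y. fst p > 0 \<Longrightarrow> k p y = l p y"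
  shows "transported f k"
proof -
  obtain g' where g': "moderate g g'" "\<And>p y. fst p > 0 \<Longrightarrow> l p y = g' p y (velocity p)"
    using transportedE[OF assms(1)] by blast
  show ?thesis
    by (rule transportedI[OF moderate_cong[OF g'(1)]]) (simp_all only: assms(2,3) g'(2))
qed

lemma transported_add:
  assumes "transported f k" "transported g l"
  shows "transported (\<lambda>p y. f p y + g p y) (\<lambda>p y. k p y + l p y)"
proof -
  obtain f' where f': "moderate f f'" "\<And>p y. fst p > 0 \<Longrightarrow> k p y = f' p y (velocity p)"
    using transportedE[OF assms(1)] by blast
  obtain g' where g': "moderate g g'" "\<And>p y. fst p > 0 \<Longrightarrow> l p y = g' p y (velocity p)"
    using transportedE[OF assms(2)] by blast
  show ?thesis
    by (rule transportedI[OF moderate_add[OF f'(1) g'(1)]]) (simp_all only: f'(2) g'(2))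
qed

lemma transported_bilinear:
  fixes B :: "'b::euclidean_space \<Rightarrow> 'c::euclidean_space \<Rightarrow> 'd::euclidean_space"
  assumes "bounded_bilinear B" "transported f k" "transported g l"
  shows "transported (\<lambda>p y. B (f p y) (g p y)) (\<lambda>p y. B (f p y) (l p y) + B (k p y) (g p y))"
proof -
  obtain f' where f': "moderate f f'" "\<And>p y. fst p > 0 \<Longrightarrow> k p y = f' p y (velocity p)"
    using transportedE[OF assms(2)] by blast
  obtain g' where g': "moderate g g'" "\<And>p y. fst p > 0 \<Longrightarrow> l p y = g' p y (velocity p)"
    using transportedE[OF assms(3)] by blast
  show ?thesis
    by (rule transportedI[OF moderate_bilinear[OF assms(1) f'(1) g'(1)]]) (simp_all only: f'(2) g'(2))
qed

lemmas transported_inner = transported_bilinear[OF bounded_bilinear_inner]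
lemmas transported_mult = transported_bilinear[OF bounded_bilinear_mult]
lemmas transported_scaleR = transported_bilinear[OF bounded_bilinear_scaleR]

lemma transported_const: "transported (\<lambda>p y. c) (\<lambda>p y. 0)"
  by (rule transportedI[OF moderate_const]) simp

lemma transported_id: "transported (\<lambda>p y. y) (\<lambda>p y. 0)"
  by (rule transportedI[OF moderate_id]) simp

lemma transported_snd:
  "transported (\<lambda>p y. snd p) (\<lambda>p y. (score_shift (fst p) / 2) *\<^sub>R snd p + (score_gain (fst p) / 2) *\<^sub>R ybar p)"
  by (rule transportedI[OF moderate_snd])
     (simp add: velocity_def modified_score_eq scaleR_add_right)

lemma transported_coeff:
  "c \<in> smooth_coeffs \<Longrightarrow> transported (\<lambda>p y. c (fst p)) (\<lambda>p y. - deriv c (fst p))"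
  by (rule transportedI[OF moderate_coeff]) (auto simp: velocity_def)

definition centered :: "real \<times> 'a \<Rightarrow> 'a \<Rightarrow> 'a" where
  "centered p y = y - ybar p"

definition drift :: "real \<times> 'a \<Rightarrow> 'a \<Rightarrow> real" where
  "drift p y = score_gain (fst p) * (1 - score_shift (fst p)) / 2 * (centered p y \<bullet> snd p)
     + (- (score_gain (fst p))\<^sup>2 / 2) * (centered p y \<bullet> ybar p)
     + (- (score_gain (fst p))\<^sup>2 / 2) * (centered p y \<bullet> centered p y)"

text \<open>Writing y as the posterior mean plus Z and expanding, the terms free of Z are exactly
  the value at y equal to the mean, and the rest is \<kappa>. A term constant in y shifts no
  covariance, so only \<kappa> matters afterwards.\<close>

lemma log_weight'_velocity:
  assumes "fst p > 0"
  shows "log_weight' p y (velocity p) = drift p y + log_weight' p (ybar p) (velocity p)"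
proof -
  define z where "z = centered p y"
  have y: "y = ybar p + z" by (simp add: z_def centered_def)
  have z: "centered p (ybar p + z) = z" by (simp add: centered_def)
  show ?thesis unfolding y drift_def z
    by (simp add: log_weight'_def velocity_def modified_score_eq[OF assms]
        inner_add_left inner_add_right inner_commute power2_eq_square field_simps)
qed

lemma poly_growth_centered: "poly_growth (centered p)"
  using poly_growth_add[OF poly_growth_id poly_growth_const[of "- ybar p"]]
  by (simp add: centered_def[abs_def])

lemma poly_growth_drift: "poly_growth (drift p)"
  unfolding drift_def[abs_def]
  by (intro poly_growth_add poly_growth_mult poly_growth_inner poly_growth_centered poly_growth_const)

lemma transported_avg:
  assumes "transported g l"
  shows "transported (\<lambda>p y. avg p (g p))
    (\<lambda>p y. avg p (\<lambda>y. drift p y *\<^sub>R g p y + l p y) - avg p (drift p) *\<^sub>R avg p (g p))"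
proof -
  obtain g' where g': "moderate g g'" "\<And>p y. fst p > 0 \<Longrightarrow> l p y = g' p y (velocity p)"
    using transportedE[OF assms] by blast
  show ?thesis
  proof (rule transportedI[OF moderate_avg[OF g'(1)]])
    fix p :: "real \<times> 'a" assume p: "fst p > 0"
    \<comment> \<open>This part does not depend on y; it contributes \<open>c\<close> times the
      average of g to both terms of the covariance and cancels.\<close>
    define c where "c = log_weight' p (ybar p) (velocity p)"
    have lw: "log_weight' p y (velocity p) = drift p y + c" for y
      unfolding c_def by (rule log_weight'_velocity[OF p])
    note pg = transported_growth[OF assms p] poly_growth_drift poly_growth_const
      poly_growth_add poly_growth_scaleR
    have "avg p (\<lambda>y. log_weight' p y (velocity p) *\<^sub>R g p y + g' p y (velocity p))
        = avg p (\<lambda>y. (drift p y *\<^sub>R g p y + l p y) + c *\<^sub>R g p y)"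
      unfolding lw g'(2)[OF p] by (simp add: algebra_simps)
    also have "\<dots> = avg p (\<lambda>y. drift p y *\<^sub>R g p y + l p y) + c *\<^sub>R avg p (g p)"
      by (simp add: avg_add[OF p] pg avg_linear[OF p _ bounded_linear_scaleR_right])
    finally have 1: "avg p (\<lambda>y. log_weight' p y (velocity p) *\<^sub>R g p y + g' p y (velocity p))
      = avg p (\<lambda>y. drift p y *\<^sub>R g p y + l p y) + c *\<^sub>R avg p (g p)" .
    have "avg p (\<lambda>y. log_weight' p y (velocity p)) = avg p (\<lambda>y. drift p y + c)"
      unfolding lw ..
    also have "\<dots> = avg p (drift p) + c"
      by (simp add: avg_add[OF p] pg avg_const[OF p])
    finally show "avg p (\<lambda>y. drift p y *\<^sub>R g p y + l p y) - avg p (drift p) *\<^sub>R avg p (g p) =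
        avg p (\<lambda>y. log_weight' p y (velocity p) *\<^sub>R g p y + g' p y (velocity p))
        - avg p (\<lambda>y. log_weight' p y (velocity p)) *\<^sub>R avg p (g p)"
      unfolding 1 by (simp add: algebra_simps)
  qed
qed

text \<open>For the integrand y, which has no parameter derivative, the covariance formula leaves
  the average of \<kappa> y minus the product of the averages; this equals the average of \<kappa>
  Z.\<close>

lemma transported_ybar:
  "transported (\<lambda>p y. ybar p) (\<lambda>p y. avg p (\<lambda>y. drift p y *\<^sub>R centered p y))"
proof (rule transported_cong[OF transported_avg[OF transported_id]])
  fix p :: "real \<times> 'a" assume p: "fst p > 0"
  have "avg p (\<lambda>y. drift p y *\<^sub>R centered p y)
      = avg p (\<lambda>y. drift p y *\<^sub>R y + - (drift p y *\<^sub>R ybar p))"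
    by (simp add: centered_def algebra_simps)
  also have "\<dots> = avg p (\<lambda>y. drift p y *\<^sub>R y) + avg p (\<lambda>y. drift p y *\<^sub>R (- ybar p))"
    unfolding scaleR_minus_right[symmetric]
    by (intro avg_add[OF p] poly_growth_scaleR poly_growth_drift poly_growth_id poly_growth_const)
  also have "avg p (\<lambda>y. drift p y *\<^sub>R (- ybar p)) = avg p (drift p) *\<^sub>R (- ybar p)"
    by (rule avg_linear[OF p poly_growth_drift bounded_linear_scaleR_left])
  finally show "avg p (\<lambda>y. drift p y *\<^sub>R centered p y)
    = avg p (\<lambda>y. drift p y *\<^sub>R y + 0) - avg p (drift p) *\<^sub>R avg p (\<lambda>y. y)"
    by (simp add: ybar_eq)
qed (rule ybar_eq)

lemma transported_centered:
  "transported centered (\<lambda>p y. - avg p (\<lambda>y. drift p y *\<^sub>R centered p y))"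
  by (rule transported_cong[OF transported_add[OF transported_id
        transported_scaleR[OF transported_const[of "- 1"] transported_ybar]]])
     (simp_all add: centered_def)

text \<open>Bridge to the separate time and space derivatives in \<open>material_deriv\<close>: the
  chain rule along the two coordinate slices recovers them from the joint derivative, and linearity
  recombines them along the velocity.\<close>

lemma transported_material:
  assumes "transported (\<lambda>p y. V (fst p) (snd p)) (\<lambda>p y. W (fst p) (snd p))" and t: "t > 0"
  shows "(\<lambda>\<tau>. V \<tau> x) differentiable (at t)" "V t differentiable (at x)"
    "material_deriv P0 V t x = W t x"
proof -
  obtain D where D: "moderate (\<lambda>p y. V (fst p) (snd p)) D"
    "\<And>p y. fst p > 0 \<Longrightarrow> W (fst p) (snd p) = D p y (velocity p)"
    using transportedE[OF assms(1)] by blast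
  \<comment> \<open>The field has no y argument, so an arbitrary value is put in that slot.\<close>
  let ?D = "D (t, x) 0"
  have d: "((\<lambda>p. V (fst p) (snd p)) has_derivative ?D) (at (t, x))"
    using moderateD(3)[OF D(1), of "(t, x)"] t by simp
  interpret bounded_linear ?D by (rule has_derivative_bounded_linear[OF d])
  have "((\<lambda>\<tau>. (\<tau>, x)) has_derivative (\<lambda>h. (h, 0))) (at t)" by (auto intro!: derivative_eq_intros)
  from has_derivative_compose[OF this d]
  have dt: "((\<lambda>\<tau>. V \<tau> x) has_derivative (\<lambda>h. ?D (h, 0))) (at t)" by simp
  have "((\<lambda>\<xi>. (t, \<xi>)) has_derivative (\<lambda>h. (0, h))) (at x)" by (auto intro!: derivative_eq_intros)
  from has_derivative_compose[OF this d]
  have dx: "(V t has_derivative (\<lambda>h. ?D (0, h))) (at x)" by simp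
  show "(\<lambda>\<tau>. V \<tau> x) differentiable (at t)" "V t differentiable (at x)"
    using dt dx unfolding differentiable_def by blast+
  have "((\<lambda>\<tau>. V \<tau> x) has_vector_derivative ?D (1, 0)) (at t)"
    unfolding has_vector_derivative_def
    by (rule has_derivative_eq_rhs[OF dt]) (simp add: scaleR[symmetric])
  then have 1: "vector_derivative (\<lambda>\<tau>. V \<tau> x) (at t) = ?D (1, 0)"
    by (rule vector_derivative_at)
  have 2: "frechet_derivative (V t) (at x) = (\<lambda>h. ?D (0, h))"
    using frechet_derivative_at[OF dx] by simp
  have "W t x = ?D (velocity (t, x))" using D(2)[of "(t, x)" 0] t by simp
  also have "velocity (t, x) = - (1, 0) + (1 / 2) *\<^sub>R (0, modified_score P0 t x)"
    by (simp add: velocity_def)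
  also have "?D \<dots> = material_deriv P0 V t x"
    unfolding material_deriv_def 1 2 by (simp only: add neg scaleR)
  finally show "material_deriv P0 V t x = W t x" ..
qed

end

subsection \<open>Normal forms\<close>

lemma scalar_algebra_cong:
  assumes "f \<in> scalar_algebra P0" "\<And>t x. t > 0 \<Longrightarrow> g t x = f t x"
  shows "g \<in> scalar_algebra P0"
  using assms unfolding scalar_algebra_def by simp

lemma scalar_algebra_coeff: "c \<in> smooth_coeffs \<Longrightarrow> (\<lambda>t x. c t) \<in> scalar_algebra P0"
  unfolding scalar_algebra_def by (auto intro!: exI[of _ "[(c, [])]"])

lemma scalar_algebra_const: "(\<lambda>t x. r) \<in> scalar_algebra P0"
  by (intro scalar_algebra_coeff smooth_coeffs_intros)

lemma scalar_algebra_atom: "S \<in> scalar_atoms P0 \<Longrightarrow> S \<in> scalar_algebra P0"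
  unfolding scalar_algebra_def
  by (auto intro!: exI[of _ "[(\<lambda>_. 1, [S])]"] smooth_coeffs_intros)

lemma scalar_algebra_add:
  assumes "f \<in> scalar_algebra P0" "g \<in> scalar_algebra P0"
  shows "(\<lambda>t x. f t x + g t x) \<in> scalar_algebra P0"
proof -
  obtain ts us where
    "\<forall>(c, Ss)\<in>set ts. c \<in> smooth_coeffs \<and> set Ss \<subseteq> scalar_atoms P0"
    "\<forall>t>0. \<forall>x. f t x = (\<Sum>(c, Ss)\<leftarrow>ts. c t * (\<Prod>S\<leftarrow>Ss. S t x))"
    "\<forall>(c, Ss)\<in>set us. c \<in> smooth_coeffs \<and> set Ss \<subseteq> scalar_atoms P0"
    "\<forall>t>0. \<forall>x. g t x = (\<Sum>(c, Ss)\<leftarrow>us. c t * (\<Prod>S\<leftarrow>Ss. S t x))"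
    using assms unfolding scalar_algebra_def by blast
  then show ?thesis
    unfolding scalar_algebra_def by (intro CollectI exI[of _ "ts @ us"]) auto
qed

lemma scalar_algebra_sum_terms:
  assumes "\<forall>(c, Ss)\<in>set ts. c \<in> smooth_coeffs \<and> set Ss \<subseteq> scalar_atoms P0"
  shows "(\<lambda>t x. \<Sum>(c, Ss)\<leftarrow>ts. c t * (\<Prod>S\<leftarrow>Ss. S t x)) \<in> scalar_algebra P0"
  using assms unfolding scalar_algebra_def by blast

lemma scalar_algebra_mult:
  assumes "f \<in> scalar_algebra P0" "g \<in> scalar_algebra P0"
  shows "(\<lambda>t x. f t x * g t x) \<in> scalar_algebra P0"
proof -
  obtain ts us where ts: "\<forall>(c, Ss)\<in>set ts. c \<in> smooth_coeffs \<and> set Ss \<subseteq> scalar_atoms P0"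
    and us: "\<forall>(c, Ss)\<in>set us. c \<in> smooth_coeffs \<and> set Ss \<subseteq> scalar_atoms P0"
    and eqs: "\<forall>t>0. \<forall>x. f t x = (\<Sum>(c, Ss)\<leftarrow>ts. c t * (\<Prod>S\<leftarrow>Ss. S t x))"
      "\<forall>t>0. \<forall>x. g t x = (\<Sum>(c, Ss)\<leftarrow>us. c t * (\<Prod>S\<leftarrow>Ss. S t x))"
    using assms unfolding scalar_algebra_def by blast
  let ?sum = "\<lambda>ts t x. \<Sum>(c, Ss)\<leftarrow>ts. c t * (\<Prod>S\<leftarrow>Ss. S t x)"
  have "(\<lambda>t x. ?sum ts t x * ?sum us t x) \<in> scalar_algebra P0"
    using ts
  proof (induction ts)
    case Nil
    show ?case using scalar_algebra_const[of 0] by simp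
  next
    case (Cons a ts)
    obtain c Ss where a: "a = (c, Ss)" by force
    \<comment> \<open>Distributes one term over all terms of the second factor: coefficients
      multiply and lists of atoms concatenate.\<close>
    let ?vs = "map (\<lambda>(d, Rs). (\<lambda>t. c t * d t, Ss @ Rs)) us"
    have "c t * (\<Prod>S\<leftarrow>Ss. S t x) * ?sum us t x = ?sum ?vs t x" for t x
      by (induction us) (auto simp: algebra_simps)
    moreover have "?sum ?vs \<in> scalar_algebra P0"
      using us Cons.prems unfolding a
      by (intro scalar_algebra_sum_terms) (fastforce intro: smooth_coeffs_intros)
    ultimately have "(\<lambda>t x. c t * (\<Prod>S\<leftarrow>Ss. S t x) * ?sum us t x) \<in> scalar_algebra P0" by simp
    from scalar_algebra_add[OF this Cons.IH] Cons.prems show ?case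
      by (simp add: a algebra_simps)
  qed
  then show ?thesis by (rule scalar_algebra_cong) (use eqs in auto)
qed

text \<open>Replaces the list representation by induction over generators and ring operations. The
  case \<open>cong\<close> is present because membership fixes a function only at positive
  times.\<close>

lemma scalar_algebra_induct [consumes 1, case_names coeff atom add mult cong]:
  assumes f: "f \<in> scalar_algebra P0"
    and coeff: "\<And>c. c \<in> smooth_coeffs \<Longrightarrow> P (\<lambda>t x. c t)"
    and atom: "\<And>S. S \<in> scalar_atoms P0 \<Longrightarrow> P S"
    and add: "\<And>f g. f \<in> scalar_algebra P0 \<Longrightarrow> g \<in> scalar_algebra P0 \<Longrightarrow> P f \<Longrightarrow> P g \<Longrightarrow>
      P (\<lambda>t x. f t x + g t x)"
    and mult: "\<And>f g. f \<in> scalar_algebra P0 \<Longrightarrow> g \<in> scalar_algebra P0 \<Longrightarrow> P f \<Longrightarrow> P g \<Longrightarrow>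
      P (\<lambda>t x. f t x * g t x)"
    and cong: "\<And>f g. P f \<Longrightarrow> (\<And>t x. t > 0 \<Longrightarrow> g t x = f t x) \<Longrightarrow> P g"
  shows "P f"
proof -
  obtain ts where ts: "\<forall>(c, Ss)\<in>set ts. c \<in> smooth_coeffs \<and> set Ss \<subseteq> scalar_atoms P0"
    and eq: "\<forall>t>0. \<forall>x. f t x = (\<Sum>(c, Ss)\<leftarrow>ts. c t * (\<Prod>S\<leftarrow>Ss. S t x))"
    using f unfolding scalar_algebra_def by blast
  have prod: "P (\<lambda>t x. c t * (\<Prod>S\<leftarrow>Ss. S t x)) \<and> (\<lambda>t x. c t * (\<Prod>S\<leftarrow>Ss. S t x)) \<in> scalar_algebra P0"
    if "c \<in> smooth_coeffs" "set Ss \<subseteq> scalar_atoms P0" for c Ss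
    using that(2)
  proof (induction Ss)
    case Nil
    show ?case using coeff[OF that(1)] scalar_algebra_coeff[OF that(1)] by simp
  next
    case (Cons S Ss)
    then have S: "S \<in> scalar_atoms P0" and *: "P (\<lambda>t x. c t * (\<Prod>S\<leftarrow>Ss. S t x))"
      "(\<lambda>t x. c t * (\<Prod>S\<leftarrow>Ss. S t x)) \<in> scalar_algebra P0" by auto
    from mult[OF scalar_algebra_atom[OF S] *(2) atom[OF S] *(1)]
      scalar_algebra_mult[OF scalar_algebra_atom[OF S] *(2)]
    show ?case by (simp add: mult_ac)
  qed
  have "P (\<lambda>t x. \<Sum>(c, Ss)\<leftarrow>ts. c t * (\<Prod>S\<leftarrow>Ss. S t x))"
    using ts
  proof (induction ts)
    case Nil
    show ?case using coeff[OF smooth_coeffs_intros(1)[of 0]] by simp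
  next
    case (Cons a ts)
    obtain c Ss where a: "a = (c, Ss)" by force
    have "P (\<lambda>t x. c t * (\<Prod>S\<leftarrow>Ss. S t x) + (\<Sum>(c, Ss)\<leftarrow>ts. c t * (\<Prod>S\<leftarrow>Ss. S t x)))"
      using Cons prod[of c Ss] by (intro add scalar_algebra_sum_terms) (auto simp: a)
    then show ?case by (simp add: a)
  qed
  then show ?thesis by (rule cong) (use eq in auto)
qed

lemma atom_module_cong:
  assumes "R \<in> atom_module P0" "\<And>t x. t > 0 \<Longrightarrow> V t x = R t x"
  shows "V \<in> atom_module P0"
  using assms unfolding atom_module_def by simp

lemma atom_module_zero: "(\<lambda>t x. 0) \<in> atom_module P0"
  unfolding atom_module_def by (auto intro!: exI[of _ "[]"])

lemma atom_module_term:
  "a \<in> scalar_algebra P0 \<Longrightarrow> M \<in> vector_atoms P0 \<Longrightarrow> (\<lambda>t x. a t x *\<^sub>R M t x) \<in> atom_module P0"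
  unfolding atom_module_def by (auto intro!: exI[of _ "[(a, M)]"])

lemma atom_module_add:
  assumes "R \<in> atom_module P0" "V \<in> atom_module P0"
  shows "(\<lambda>t x. R t x + V t x) \<in> atom_module P0"
proof -
  obtain ts us where "set ts \<subseteq> scalar_algebra P0 \<times> vector_atoms P0"
    "\<forall>t>0. \<forall>x. R t x = (\<Sum>(f, M)\<leftarrow>ts. f t x *\<^sub>R M t x)"
    "set us \<subseteq> scalar_algebra P0 \<times> vector_atoms P0"
    "\<forall>t>0. \<forall>x. V t x = (\<Sum>(f, M)\<leftarrow>us. f t x *\<^sub>R M t x)"
    using assms unfolding atom_module_def by blast
  then show ?thesis unfolding atom_module_def by (intro CollectI exI[of _ "ts @ us"]) auto
qed

lemma atom_module_induct [consumes 1, case_names zero add cong]: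
  assumes R: "R \<in> atom_module P0"
    and zero: "P (\<lambda>t x. 0)"
    and add: "\<And>a M R. a \<in> scalar_algebra P0 \<Longrightarrow> M \<in> vector_atoms P0 \<Longrightarrow> R \<in> atom_module P0 \<Longrightarrow> P R \<Longrightarrow>
      P (\<lambda>t x. a t x *\<^sub>R M t x + R t x)"
    and cong: "\<And>R V. P R \<Longrightarrow> (\<And>t x. t > 0 \<Longrightarrow> V t x = R t x) \<Longrightarrow> P V"
  shows "P R"
proof -
  obtain ts where ts: "set ts \<subseteq> scalar_algebra P0 \<times> vector_atoms P0"
    and eq: "\<forall>t>0. \<forall>x. R t x = (\<Sum>(f, M)\<leftarrow>ts. f t x *\<^sub>R M t x)"
    using R unfolding atom_module_def by blast
  \<comment> \<open>Membership is carried along with the property because the rule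
    \<open>add\<close> demands it of the remaining sum.\<close>
  have "P (\<lambda>t x. \<Sum>(f, M)\<leftarrow>ts. f t x *\<^sub>R M t x) \<and>
    (\<lambda>t x. \<Sum>(f, M)\<leftarrow>ts. f t x *\<^sub>R M t x) \<in> atom_module P0"
    using ts
  proof (induction ts)
    case Nil
    show ?case using zero atom_module_zero by simp
  next
    case (Cons b ts)
    obtain a M where b: "b = (a, M)" by force
    then show ?case
      using Cons add[of a M] atom_module_add[OF atom_module_term[of a P0 M]] by auto
  qed
  then have "P (\<lambda>t x. \<Sum>(f, M)\<leftarrow>ts. f t x *\<^sub>R M t x)" by blast
  then show ?thesis by (rule cong) (use eq in auto)
qed

lemma atom_module_scale:
  assumes a: "a \<in> scalar_algebra P0" and R: "R \<in> atom_module P0"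
  shows "(\<lambda>t x. a t x *\<^sub>R R t x) \<in> atom_module P0"
  using R
proof (induction rule: atom_module_induct)
  case zero
  show ?case using atom_module_zero by simp
next
  case (add b M R)
  from atom_module_add[OF atom_module_term[OF scalar_algebra_mult[OF a add(1)] add(2)] add(4)]
  show ?case by (simp add: scaleR_add_right)
next
  case (cong R V)
  from cong(1) show ?case by (rule atom_module_cong) (simp add: cong(2))
qed

section \<open>The ring of integrands and its averages\<close>

context prior
begin

text \<open>The factor common to both kinds of atoms: its average is the scalar atom, and its
  average after multiplication by Z is the vector atom.\<close>

definition monomial ::
    "nat \<Rightarrow> nat \<Rightarrow> (real \<Rightarrow> 'a \<Rightarrow> 'a) list \<Rightarrow> real \<times> 'a \<Rightarrow> 'a \<Rightarrow> real" where
  "monomial k m Us p y = (centered p y \<bullet> snd p) ^ k * norm (centered p y) ^ m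
     * (\<Prod>U\<leftarrow>Us. centered p y \<bullet> U (fst p) (snd p))"

lemma scalar_atom_eq: "scalar_atom P0 k m Us t x = avg (t, x) (monomial k m Us (t, x))"
  by (simp add: scalar_atom_def avg_def monomial_def[abs_def] centered_def Let_def)

lemma vector_atom_eq:
  "vector_atom P0 k m Us t x = avg (t, x) (\<lambda>y. monomial k m Us (t, x) y *\<^sub>R centered (t, x) y)"
  by (simp add: vector_atom_def avg_def monomial_def centered_def Let_def)

lemmas scalar_atom_eq_fun = ext[OF ext[OF scalar_atom_eq]]
lemmas vector_atom_eq_fun = ext[OF ext[OF vector_atom_eq]]

lemma monomial_mult:
  "monomial k m Us p y * monomial k' m' Us' p y = monomial (k + k') (m + m') (Us @ Us') p y"
  by (simp add: monomial_def power_add mult_ac)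

lemma poly_growth_power:
  fixes f :: "'a \<Rightarrow> real"
  shows "poly_growth f \<Longrightarrow> poly_growth (\<lambda>y. f y ^ n)"
  by (induction n) (simp_all add: poly_growth_const poly_growth_mult)

lemma poly_growth_norm:
  fixes f :: "'a \<Rightarrow> 'a"
  shows "poly_growth f \<Longrightarrow> poly_growth (\<lambda>y. norm (f y))"
  unfolding poly_growth_def by auto

lemma poly_growth_monomial: "poly_growth (monomial k m Us p)"
proof -
  have "poly_growth (\<lambda>y. \<Prod>U\<leftarrow>Us. centered p y \<bullet> U (fst p) (snd p))"
    by (induction Us)
       (simp_all add: poly_growth_const poly_growth_mult poly_growth_inner poly_growth_centered)
  then show ?thesis unfolding monomial_def[abs_def]
    by (intro poly_growth_mult poly_growth_power poly_growth_norm poly_growth_inner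
        poly_growth_centered poly_growth_const)
qed

text \<open>The coefficients come from the whole algebra rather than from functions of t, because
  differentiating Z creates factors that depend on x through averages.\<close>

inductive_set integrands :: "(real \<times> 'a \<Rightarrow> 'a \<Rightarrow> real) set" where
  monomial: "a \<in> scalar_algebra P0 \<Longrightarrow> even m \<Longrightarrow> set Us \<subseteq> insertions P0 \<Longrightarrow>
    (\<lambda>p y. a (fst p) (snd p) * monomial k m Us p y) \<in> integrands"
| add: "f \<in> integrands \<Longrightarrow> g \<in> integrands \<Longrightarrow> (\<lambda>p y. f p y + g p y) \<in> integrands"
| eq_on: "f \<in> integrands \<Longrightarrow> (\<And>p y. fst p > 0 \<Longrightarrow> g p y = f p y) \<Longrightarrow> g \<in> integrands"

lemma integrands_mult:
  assumes "f \<in> integrands" "g \<in> integrands"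
  shows "(\<lambda>p y. f p y * g p y) \<in> integrands"
  using assms(1)
proof induction
  case f: (monomial a m Us k)
  show ?case using assms(2)
  proof induction
    case (monomial b m' Us' k')
    have "(\<lambda>p y. (a (fst p) (snd p) * b (fst p) (snd p)) * monomial (k + k') (m + m') (Us @ Us') p y)
        \<in> integrands"
      using f monomial integrands.monomial[OF scalar_algebra_mult[OF f(1) monomial(1)]] by auto
    then show ?case by (simp add: monomial_mult[symmetric] mult_ac)
  next
    case (add g h)
    from integrands.add[OF add(3,4)] show ?case by (simp add: algebra_simps)
  next
    case (eq_on g h)
    from eq_on(3) show ?case by (rule integrands.eq_on) (simp add: eq_on(2))
  qed
next
  case (add f h)
  from integrands.add[OF add(3,4)] show ?case by (simp add: algebra_simps)
next
  case (eq_on f h)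
  from eq_on(3) show ?case by (rule integrands.eq_on) (simp add: eq_on(2))
qed

lemma integrands_scalar:
  "a \<in> scalar_algebra P0 \<Longrightarrow> (\<lambda>p y. a (fst p) (snd p)) \<in> integrands"
  using integrands.monomial[of a 0 "[]" 0] by (simp add: monomial_def)

lemma integrands_const: "(\<lambda>p y. r) \<in> integrands"
  by (rule integrands_scalar[OF scalar_algebra_const])

lemma integrands_coeff: "c \<in> smooth_coeffs \<Longrightarrow> (\<lambda>p y. c (fst p)) \<in> integrands"
  by (rule integrands_scalar[OF scalar_algebra_coeff])

lemma integrands_minus: "f \<in> integrands \<Longrightarrow> (\<lambda>p y. - f p y) \<in> integrands"
  using integrands_mult[OF integrands_const[of "- 1"]] by simp

lemma integrands_x: "(\<lambda>p y. centered p y \<bullet> snd p) \<in> integrands"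
  using integrands.monomial[OF scalar_algebra_const, of 0 "[]" 1 1] by (simp add: monomial_def)

lemma integrands_square: "(\<lambda>p y. centered p y \<bullet> centered p y) \<in> integrands"
  using integrands.monomial[OF scalar_algebra_const, of 2 "[]" 1 0]
  by (simp add: monomial_def power2_norm_eq_inner)

lemma integrands_insertion:
  "U \<in> insertions P0 \<Longrightarrow> (\<lambda>p y. centered p y \<bullet> U (fst p) (snd p)) \<in> integrands"
  using integrands.monomial[OF scalar_algebra_const, of 0 "[U]" 1 0] by (simp add: monomial_def)

lemma integrands_growth: "f \<in> integrands \<Longrightarrow> fst p > 0 \<Longrightarrow> poly_growth (f p)"
proof (induction rule: integrands.induct)
  case (eq_on f g)
  have "g p = f p" using eq_on(2)[OF eq_on(4)] by (rule ext)
  with eq_on(3)[OF eq_on(4)] show ?case by simp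
qed (simp_all add: poly_growth_mult poly_growth_const poly_growth_monomial poly_growth_add)

text \<open>Algebra coefficients do not depend on y and leave the average by linearity; what remains
  of each monomial is a scalar atom.\<close>

lemma avg_integrand:
  assumes "f \<in> integrands"
  shows "(\<lambda>t x. avg (t, x) (f (t, x))) \<in> scalar_algebra P0"
  using assms
proof induction
  case (monomial a m Us k)
  have "scalar_atom P0 k m Us \<in> scalar_algebra P0"
    using monomial by (intro scalar_algebra_atom) (auto simp: scalar_atoms_def)
  from scalar_algebra_mult[OF monomial(1) this] show ?case
    by (rule scalar_algebra_cong)
       (simp add: scalar_atom_eq avg_linear[OF _ poly_growth_monomial bounded_linear_mult_right])
next
  case (add f g)
  from scalar_algebra_add[OF add(3,4)] show ?case
    by (rule scalar_algebra_cong) (simp add: avg_add integrands_growth add)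
next
  case (eq_on f g)
  have "g (t, x) = f (t, x)" if "t > 0" for t x using eq_on(2)[of "(t, x)"] that by auto
  with eq_on(3) show ?case by (auto elim: scalar_algebra_cong)
qed

lemma avg_integrand_centered:
  assumes "f \<in> integrands"
  shows "(\<lambda>t x. avg (t, x) (\<lambda>y. f (t, x) y *\<^sub>R centered (t, x) y)) \<in> atom_module P0"
  using assms
proof induction
  case (monomial a m Us k)
  have "vector_atom P0 k m Us \<in> vector_atoms P0"
    using monomial by (auto simp: vector_atoms_def)
  from atom_module_term[OF monomial(1) this] show ?case
  proof (rule atom_module_cong)
    fix t :: real and x :: 'a assume t: "t > 0"
    have "avg (t, x) (\<lambda>y. a t x *\<^sub>R (monomial k m Us (t, x) y *\<^sub>R centered (t, x) y))
        = a t x *\<^sub>R avg (t, x) (\<lambda>y. monomial k m Us (t, x) y *\<^sub>R centered (t, x) y)"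
      using t by (intro avg_linear poly_growth_scaleR poly_growth_monomial poly_growth_centered
          bounded_linear_scaleR_right) auto
    then show "avg (t, x) (\<lambda>y. (a (fst (t, x)) (snd (t, x)) * monomial k m Us (t, x) y) *\<^sub>R centered (t, x) y)
        = a t x *\<^sub>R vector_atom P0 k m Us t x"
      by (simp add: vector_atom_eq)
  qed
next
  case (add f g)
  from atom_module_add[OF add(3,4)] show ?case
    by (rule atom_module_cong)
       (simp add: avg_add integrands_growth add scaleR_add_left poly_growth_scaleR poly_growth_centered)
next
  case (eq_on f g)
  have "g (t, x) = f (t, x)" if "t > 0" for t x using eq_on(2)[of "(t, x)"] that by auto
  with eq_on(3) show ?case by (auto elim: atom_module_cong)
qed

text \<open>The inner product with a fixed vector moves inside the average, where it becomes one
  more factor of the monomial.\<close>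

lemma vector_atom_inner:
  assumes t: "t > 0"
  shows "vector_atom P0 k m Us t x \<bullet> x = scalar_atom P0 (Suc k) m Us t x"
    and "vector_atom P0 k m Us t x \<bullet> U t x = scalar_atom P0 k m (U # Us) t x"
proof -
  have "vector_atom P0 k m Us t x \<bullet> v
      = avg (t, x) (\<lambda>y. monomial k m Us (t, x) y * (centered (t, x) y \<bullet> v))" for v
    unfolding vector_atom_eq inner_scaleR_left[symmetric]
    using t by (intro avg_linear[symmetric] poly_growth_scaleR poly_growth_monomial poly_growth_centered
        bounded_linear_inner_left) auto
  then show "vector_atom P0 k m Us t x \<bullet> x = scalar_atom P0 (Suc k) m Us t x"
    "vector_atom P0 k m Us t x \<bullet> U t x = scalar_atom P0 k m (U # Us) t x"
    by (simp_all add: scalar_atom_eq monomial_def[abs_def] mult_ac)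
qed

lemma atom_module_inner:
  assumes R: "R \<in> atom_module P0" and W: "W = (\<lambda>t x. x) \<or> W \<in> insertions P0"
  shows "(\<lambda>t x. R t x \<bullet> W t x) \<in> scalar_algebra P0"
  using R
proof (induction rule: atom_module_induct)
  case zero
  show ?case using scalar_algebra_const[of 0] by simp
next
  case (add a M R)
  obtain k m Us where M: "M = vector_atom P0 k m Us" "even m" "set Us \<subseteq> insertions P0"
    using add(2) by (auto simp: vector_atoms_def)
  have "\<exists>S\<in>scalar_atoms P0. \<forall>t>0. \<forall>x. M t x \<bullet> W t x = S t x"
    using W
  proof
    assume "W = (\<lambda>t x. x)"
    then show ?thesis
      using M by (intro bexI[of _ "scalar_atom P0 (Suc k) m Us"])
        (auto simp: vector_atom_inner scalar_atoms_def)
  next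
    assume "W \<in> insertions P0"
    then have "scalar_atom P0 k m (W # Us) \<in> scalar_atoms P0"
      using M unfolding scalar_atoms_def by (intro CollectI exI[of _ k] exI[of _ m] exI[of _ "W # Us"]) auto
    then show ?thesis by (intro bexI) (auto simp: vector_atom_inner M)
  qed
  then obtain S where S: "S \<in> scalar_atoms P0" "\<And>t x. t > 0 \<Longrightarrow> M t x \<bullet> W t x = S t x" by blast
  from scalar_algebra_add[OF scalar_algebra_mult[OF add(1) scalar_algebra_atom[OF S(1)]] add(4)]
  show ?case by (rule scalar_algebra_cong) (simp add: inner_add_left S(2))
next
  case (cong R V)
  from cong(1) show ?case by (rule scalar_algebra_cong) (simp add: cong(2))
qed

text \<open>Every vector atom is itself an insertion, so pairing Z with a term of the module gives
  an algebra coefficient times a monomial; the x and mean parts are monomials too. This keeps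
  derivatives of insertions inside the ring of integrands.\<close>

lemma integrands_centered_inner:
  assumes "V \<in> normal_forms P0"
  shows "(\<lambda>p y. centered p y \<bullet> V (fst p) (snd p)) \<in> integrands"
proof -
  obtain A B R where A: "A \<in> smooth_coeffs" and B: "B \<in> smooth_coeffs" and R: "R \<in> atom_module P0"
    and V: "\<forall>t>0. \<forall>x. V t x = A t *\<^sub>R x + B t *\<^sub>R posterior_mean P0 t x + R t x"
    using assms by (auto simp: normal_forms_def)
  have "(\<lambda>p y. centered p y \<bullet> R (fst p) (snd p)) \<in> integrands"
    using R
  proof (induction rule: atom_module_induct)
    case zero
    show ?case using integrands_const[of 0] by simp
  next
    case (add a M R)
    have "M \<in> insertions P0"
      using add(2) by (auto simp: vector_atoms_def intro!: insertions.atom)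
    from integrands.add[OF integrands_mult[OF integrands_scalar[OF add(1)] integrands_insertion[OF this]] add(4)]
    show ?case by (simp add: inner_add_right)
  next
    case (cong R V)
    from cong(1) show ?case by (rule integrands.eq_on) (simp add: cong(2))
  qed
  from integrands.add[OF integrands.add[OF
      integrands_mult[OF integrands_coeff[OF A] integrands_x]
      integrands_mult[OF integrands_coeff[OF B] integrands_insertion[OF insertions.mean]]] this]
  show ?thesis by (rule integrands.eq_on) (simp add: V inner_add_right)
qed

lemma integrands_drift: "drift \<in> integrands"
proof -
  have "(\<lambda>t. score_gain t * (1 + (- 1) * score_shift t) * (1 / 2)) \<in> smooth_coeffs"
    "(\<lambda>t. (- 1 / 2) * (score_gain t * score_gain t)) \<in> smooth_coeffs"
    by (intro smooth_coeffs_intros)+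
  note c = this[THEN integrands_coeff]
  from integrands.add[OF integrands.add[OF integrands_mult[OF c(1) integrands_x]
      integrands_mult[OF c(2) integrands_insertion[OF insertions.mean]]]
      integrands_mult[OF c(2) integrands_square]]
  show ?thesis by (rule integrands.eq_on) (simp add: drift_def power2_eq_square)
qed

section \<open>Material derivatives of integrands, insertions and atoms\<close>

definition mean_flow :: "real \<Rightarrow> 'a \<Rightarrow> 'a" where
  "mean_flow t x = avg (t, x) (\<lambda>y. drift (t, x) y *\<^sub>R centered (t, x) y)"

text \<open>Since \<kappa> is an integrand, the average of \<kappa> Z, which is the material
  derivative of the posterior mean, lies in the module.\<close>

lemma mean_flow_atom_module: "mean_flow \<in> atom_module P0"
  using avg_integrand_centered[OF integrands_drift] by (simp add: mean_flow_def[abs_def])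

definition flows :: "(real \<Rightarrow> 'a \<Rightarrow> 'b::euclidean_space) \<Rightarrow> (real \<Rightarrow> 'a \<Rightarrow> 'b) \<Rightarrow> bool" where
  "flows V W \<longleftrightarrow> transported (\<lambda>p y. V (fst p) (snd p)) (\<lambda>p y. W (fst p) (snd p))"

lemma flows_cong:
  assumes "flows V W" "\<And>t x. t > 0 \<Longrightarrow> V' t x = V t x"
  shows "flows V' W"
  using assms(1) unfolding flows_def by (rule transported_cong) (simp_all add: assms(2))

lemma flows_mean: "flows (posterior_mean P0) mean_flow"
  using transported_ybar by (simp add: flows_def mean_flow_def)

lemma transported_centered': "transported centered (\<lambda>p y. - mean_flow (fst p) (snd p))"
  using transported_centered by (simp add: mean_flow_def)

text \<open>The derivative only has to be an integrand, not to be closed again; one differentiation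
  at a time is enough, and this avoids circularity with the derivatives of insertions.\<close>

definition flow_closed :: "(real \<times> 'a \<Rightarrow> 'a \<Rightarrow> real) \<Rightarrow> bool" where
  "flow_closed f \<longleftrightarrow> f \<in> integrands \<and> (\<exists>l\<in>integrands. transported f l)"

lemma flow_closedI: "f \<in> integrands \<Longrightarrow> l \<in> integrands \<Longrightarrow> transported f l \<Longrightarrow> flow_closed f"
  unfolding flow_closed_def by blast

lemma flow_closed_mult:
  assumes "flow_closed f" "flow_closed g"
  shows "flow_closed (\<lambda>p y. f p y * g p y)"
proof -
  obtain k l where *: "f \<in> integrands" "k \<in> integrands" "transported f k"
    "g \<in> integrands" "l \<in> integrands" "transported g l"
    using assms unfolding flow_closed_def by blast
  show ?thesis
    by (rule flow_closedI[OF _ _ transported_mult[OF *(3,6)]])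
       (intro integrands.add integrands_mult *)+
qed

lemma flow_closed_one: "flow_closed (\<lambda>p y. 1)"
  by (rule flow_closedI[OF integrands_const integrands_const transported_const])

lemma flow_closed_power: "flow_closed f \<Longrightarrow> flow_closed (\<lambda>p y. f p y ^ n)"
  by (induction n) (simp_all add: flow_closed_one flow_closed_mult)

lemma identity_normal_form: "(\<lambda>t x. x) \<in> normal_forms P0"
  unfolding normal_forms_def using smooth_coeffs_intros(1)[of 1] smooth_coeffs_intros(1)[of 0] atom_module_zero
  by (intro CollectI bexI[of _ "\<lambda>_. 1"] bexI[of _ "\<lambda>_. 0"] bexI[of _ "\<lambda>t x. 0"]) auto

lemma normal_formsI:
  "A \<in> smooth_coeffs \<Longrightarrow> B \<in> smooth_coeffs \<Longrightarrow> R \<in> atom_module P0 \<Longrightarrow>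
    (\<And>t x. t > 0 \<Longrightarrow> V t x = A t *\<^sub>R x + B t *\<^sub>R posterior_mean P0 t x + R t x) \<Longrightarrow> V \<in> normal_forms P0"
  unfolding normal_forms_def by blast

lemma atom_module_normal_form: "R \<in> atom_module P0 \<Longrightarrow> R \<in> normal_forms P0"
  by (rule normal_formsI[OF smooth_coeffs_intros(1)[of 0] smooth_coeffs_intros(1)[of 0]]) auto

text \<open>By the product rule the derivative of the pairing of Z with W is the pairing of Z with L
  W minus the pairing of \<open>mean_flow\<close> with W. The first is an integrand because L W is a
  normal form, the second is an algebra element.\<close>

lemma flow_closed_centered_inner:
  assumes W: "W = (\<lambda>t x. x) \<or> W \<in> insertions P0" and "flows W L" "L \<in> normal_forms P0"
  shows "flow_closed (\<lambda>p y. centered p y \<bullet> W (fst p) (snd p))"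
proof (rule flow_closedI)
  show "(\<lambda>p y. centered p y \<bullet> W (fst p) (snd p)) \<in> integrands"
    using W integrands_x integrands_insertion by auto
  show "transported (\<lambda>p y. centered p y \<bullet> W (fst p) (snd p))
    (\<lambda>p y. centered p y \<bullet> L (fst p) (snd p) + (- mean_flow (fst p) (snd p)) \<bullet> W (fst p) (snd p))"
    using transported_inner[OF transported_centered' assms(2)[unfolded flows_def]] .
  have "(\<lambda>p y. - (mean_flow (fst p) (snd p) \<bullet> W (fst p) (snd p))) \<in> integrands"
    by (rule integrands_minus[OF integrands_scalar[OF atom_module_inner[OF mean_flow_atom_module W]]])
  from integrands.add[OF integrands_centered_inner[OF assms(3)] this]
  show "(\<lambda>p y. centered p y \<bullet> L (fst p) (snd p) + (- mean_flow (fst p) (snd p)) \<bullet> W (fst p) (snd p)) \<in> integrands"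
    by simp
qed

lemma flow_closed_square: "flow_closed (\<lambda>p y. centered p y \<bullet> centered p y)"
proof (rule flow_closedI[OF integrands_square _ transported_inner[OF transported_centered' transported_centered']])
  have *: "(\<lambda>p y. - (centered p y \<bullet> mean_flow (fst p) (snd p))) \<in> integrands"
    by (intro integrands_minus integrands_centered_inner atom_module_normal_form mean_flow_atom_module)
  from integrands.add[OF * *]
  show "(\<lambda>p y. centered p y \<bullet> (- mean_flow (fst p) (snd p)) + (- mean_flow (fst p) (snd p)) \<bullet> centered p y) \<in> integrands"
    by (simp add: inner_commute)
qed

lemma flows_identity:
  "flows (\<lambda>t x. x) (\<lambda>t x. (score_shift t / 2) *\<^sub>R x + (score_gain t / 2) *\<^sub>R posterior_mean P0 t x)"
  using transported_snd by (simp add: flows_def)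

lemma identity_flow_normal_form:
  "(\<lambda>t x. (score_shift t / 2) *\<^sub>R x + (score_gain t / 2) *\<^sub>R posterior_mean P0 t x) \<in> normal_forms P0"
proof (rule normal_formsI[OF _ _ atom_module_zero])
  show "(\<lambda>t. score_shift t * (1 / 2)) \<in> smooth_coeffs" "(\<lambda>t. score_gain t * (1 / 2)) \<in> smooth_coeffs"
    by (intro smooth_coeffs_intros)+
qed simp

lemma flow_closed_monomial:
  assumes "even m" and Us: "\<forall>U\<in>set Us. U \<in> insertions P0 \<and> (\<exists>L\<in>normal_forms P0. flows U L)"
  shows "flow_closed (monomial k m Us)"
proof -
  have "flow_closed (\<lambda>p y. \<Prod>U\<leftarrow>Us. centered p y \<bullet> U (fst p) (snd p))"
    using Us by (induction Us) (auto simp: flow_closed_one intro!: flow_closed_mult flow_closed_centered_inner)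
  moreover have "flow_closed (\<lambda>p y. norm (centered p y) ^ m)"
  proof -
    \<comment> \<open>Evenness turns the power of the norm into a power of the inner product of Z
      with itself, which is differentiable also where Z = 0.\<close>
    obtain n where "m = 2 * n" using assms(1) by (elim evenE)
    then show ?thesis using flow_closed_power[OF flow_closed_square, of n]
      by (simp add: power_mult power2_norm_eq_inner)
  qed
  moreover have "flow_closed (\<lambda>p y. (centered p y \<bullet> snd p) ^ k)"
    using flow_closed_centered_inner[OF _ flows_identity identity_flow_normal_form]
    by (intro flow_closed_power) auto
  ultimately show ?thesis unfolding monomial_def[abs_def] by (intro flow_closed_mult)
qed

lemma flow_closed_avg:
  assumes "flow_closed f"
  shows "\<exists>L\<in>scalar_algebra P0. flows (\<lambda>t x. avg (t, x) (f (t, x))) L"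
proof -
  obtain l where *: "f \<in> integrands" "l \<in> integrands" "transported f l"
    using assms unfolding flow_closed_def by blast
  let ?L = "\<lambda>t x. avg (t, x) (\<lambda>y. drift (t, x) y * f (t, x) y + l (t, x) y)
    + - 1 * (avg (t, x) (drift (t, x)) * avg (t, x) (f (t, x)))"
  have "?L \<in> scalar_algebra P0"
    by (intro scalar_algebra_add scalar_algebra_mult avg_integrand scalar_algebra_const
        avg_integrand[where f = "\<lambda>p y. drift p y * f p y + l p y"] integrands.add integrands_mult
        integrands_drift *)
  moreover have "flows (\<lambda>t x. avg (t, x) (f (t, x))) ?L"
    using transported_avg[OF *(3)] by (simp add: flows_def)
  ultimately show ?thesis by blast
qed

lemma flow_closed_avg_centered:
  assumes "flow_closed f"
  shows "\<exists>L\<in>atom_module P0. flows (\<lambda>t x. avg (t, x) (\<lambda>y. f (t, x) y *\<^sub>R centered (t, x) y)) L"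
proof -
  obtain l where *: "f \<in> integrands" "l \<in> integrands" "transported f l"
    using assms unfolding flow_closed_def by blast
  let ?m = "\<lambda>f t x. avg (t, x) (\<lambda>y. f (t, x) y *\<^sub>R centered (t, x) y)"
  \<comment> \<open>Three contributions: \<kappa> f plus the derivative of f, paired with Z; the
    derivative of Z, which factors out as the average of f; and the subtracted product of
    averages.\<close>
  let ?L = "\<lambda>t x. ?m (\<lambda>p y. drift p y * f p y + l p y) t x
    + ((- 1 * avg (t, x) (f (t, x))) *\<^sub>R mean_flow t x
    + (- 1 * avg (t, x) (drift (t, x))) *\<^sub>R ?m f t x)"
  have "?L \<in> atom_module P0"
    by (intro atom_module_add atom_module_scale avg_integrand_centered mean_flow_atom_module
        scalar_algebra_mult scalar_algebra_const avg_integrand integrands.add integrands_mult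
        integrands_drift *)
  moreover have "flows (?m f) ?L"
    unfolding flows_def
  proof (rule transported_cong[OF transported_avg[OF transported_scaleR[OF *(3) transported_centered']]])
    fix p :: "real \<times> 'a" assume p: "fst p > 0"
    note g = integrands_growth[OF *(1) p] integrands_growth[OF *(2) p]
    have "avg p (\<lambda>y. drift p y *\<^sub>R (f p y *\<^sub>R centered p y)
          + (f p y *\<^sub>R (- mean_flow (fst p) (snd p)) + l p y *\<^sub>R centered p y))
        = avg p (\<lambda>y. (drift p y * f p y + l p y) *\<^sub>R centered p y + f p y *\<^sub>R (- mean_flow (fst p) (snd p)))"
      by (simp add: algebra_simps)
    also have "\<dots> = avg p (\<lambda>y. (drift p y * f p y + l p y) *\<^sub>R centered p y)
        + avg p (\<lambda>y. f p y *\<^sub>R (- mean_flow (fst p) (snd p)))"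
      by (intro avg_add[OF p] poly_growth_scaleR poly_growth_add poly_growth_mult poly_growth_drift
          poly_growth_centered poly_growth_const g)
    also have "avg p (\<lambda>y. f p y *\<^sub>R (- mean_flow (fst p) (snd p))) = avg p (f p) *\<^sub>R (- mean_flow (fst p) (snd p))"
      by (rule avg_linear[OF p g(1) bounded_linear_scaleR_left])
    finally show "?L (fst p) (snd p) = avg p (\<lambda>y. drift p y *\<^sub>R (f p y *\<^sub>R centered p y)
          + (f p y *\<^sub>R (- mean_flow (fst p) (snd p)) + l p y *\<^sub>R centered p y))
        - avg p (drift p) *\<^sub>R avg p (\<lambda>y. f p y *\<^sub>R centered p y)"
      by simp
  qed simp
  ultimately show ?thesis by blast
qed

text \<open>Induction on the nesting of insertions: differentiating an atom requires only that each
  inserted field has a normal-form derivative, which is the induction hypothesis.\<close>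

lemma insertion_flow:
  assumes "U \<in> insertions P0"
  shows "\<exists>L\<in>normal_forms P0. flows U L"
  using assms
proof induction
  case mean
  show ?case by (rule bexI, rule flows_mean) (intro atom_module_normal_form mean_flow_atom_module)
next
  case (atom Us m k)
  have "flow_closed (monomial k m Us)"
    by (rule flow_closed_monomial[OF atom(2)]) (use atom(1) in auto)
  from flow_closed_avg_centered[OF this] obtain L
    where "L \<in> atom_module P0" "flows (vector_atom P0 k m Us) L"
    unfolding vector_atom_eq_fun by (rule bexE)
  then show ?case by (intro bexI[of _ L] atom_module_normal_form)
qed

lemma flow_closed_monomial_insertions:
  "even m \<Longrightarrow> set Us \<subseteq> insertions P0 \<Longrightarrow> flow_closed (monomial k m Us)"
  by (intro flow_closed_monomial) (auto intro!: insertion_flow)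

lemma vector_atom_flow:
  assumes "M \<in> vector_atoms P0"
  shows "\<exists>L\<in>atom_module P0. flows M L"
proof -
  obtain k m Us where M: "M = vector_atom P0 k m Us" "even m" "set Us \<subseteq> insertions P0"
    using assms by (auto simp: vector_atoms_def)
  show ?thesis unfolding M(1) vector_atom_eq_fun
    by (rule flow_closed_avg_centered[OF flow_closed_monomial_insertions[OF M(2,3)]])
qed

lemma scalar_atom_flow:
  assumes "S \<in> scalar_atoms P0"
  shows "\<exists>L\<in>scalar_algebra P0. flows S L"
proof -
  obtain k m Us where S: "S = scalar_atom P0 k m Us" "even m" "set Us \<subseteq> insertions P0"
    using assms by (auto simp: scalar_atoms_def)
  show ?thesis unfolding S(1) scalar_atom_eq_fun
    by (rule flow_closed_avg[OF flow_closed_monomial_insertions[OF S(2,3)]])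
qed

section \<open>Product rules and invariance of the normal forms\<close>

lemma flows_add:
  assumes "flows V V'" "flows W W'"
  shows "flows (\<lambda>t x. V t x + W t x) (\<lambda>t x. V' t x + W' t x)"
  using transported_add[OF assms[unfolded flows_def]] unfolding flows_def .

lemma flows_scaleR:
  assumes "flows f f'" "flows W W'"
  shows "flows (\<lambda>t x. f t x *\<^sub>R W t x) (\<lambda>t x. f t x *\<^sub>R W' t x + f' t x *\<^sub>R W t x)"
  using transported_scaleR[OF assms[unfolded flows_def]] unfolding flows_def .

lemma flows_mult:
  fixes f g :: "real \<Rightarrow> 'a \<Rightarrow> real"
  assumes "flows f f'" "flows g g'"
  shows "flows (\<lambda>t x. f t x * g t x) (\<lambda>t x. f t x * g' t x + f' t x * g t x)"
  using transported_mult[OF assms[unfolded flows_def]] unfolding flows_def .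

lemma flows_coeff: "c \<in> smooth_coeffs \<Longrightarrow> flows (\<lambda>t x. c t) (\<lambda>t x. - deriv c t)"
  using transported_coeff[of c] unfolding flows_def .

lemma smooth_coeffs_minus_deriv:
  assumes "c \<in> smooth_coeffs"
  shows "(\<lambda>t. - deriv c t) \<in> smooth_coeffs"
proof -
  have "(\<lambda>t. - 1 * deriv c t) \<in> smooth_coeffs"
    by (intro smooth_coeffs_intros smooth_coeffs_deriv(1) assms)
  then show ?thesis by simp
qed

lemma scalar_algebra_flow:
  assumes "f \<in> scalar_algebra P0"
  shows "\<exists>L\<in>scalar_algebra P0. flows f L"
  using assms
proof (induction rule: scalar_algebra_induct)
  case (coeff c)
  then show ?case
    by (intro bexI, rule flows_coeff) (auto intro: scalar_algebra_coeff smooth_coeffs_minus_deriv)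
next
  case (atom S)
  then show ?case by (rule scalar_atom_flow)
next
  case (add f g)
  obtain f' where f': "f' \<in> scalar_algebra P0" "flows f f'" using add(3) by (rule bexE)
  obtain g' where g': "g' \<in> scalar_algebra P0" "flows g g'" using add(4) by (rule bexE)
  show ?case
    by (rule bexI, rule flows_add[OF f'(2) g'(2)]) (rule scalar_algebra_add[OF f'(1) g'(1)])
next
  case (mult f g)
  obtain f' where f': "f' \<in> scalar_algebra P0" "flows f f'" using mult(3) by (rule bexE)
  obtain g' where g': "g' \<in> scalar_algebra P0" "flows g g'" using mult(4) by (rule bexE)
  show ?case
    by (rule bexI, rule flows_mult[OF f'(2) g'(2)])
       (intro scalar_algebra_add scalar_algebra_mult mult f' g')
next
  case (cong f g)
  obtain f' where f': "f' \<in> scalar_algebra P0" "flows f f'" using cong(1) by (rule bexE)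
  have "flows g f'" by (rule flows_cong[OF f'(2) cong(2)])
  then show ?case using f'(1) by (rule bexI)
qed

lemma atom_module_flow:
  assumes "R \<in> atom_module P0"
  shows "\<exists>L\<in>atom_module P0. flows R L"
  using assms
proof (induction rule: atom_module_induct)
  case zero
  show ?case
    unfolding flows_def by (rule bexI, rule transported_const) (rule atom_module_zero)
next
  case (add a M R)
  obtain a' where a': "a' \<in> scalar_algebra P0" "flows a a'" using scalar_algebra_flow[OF add(1)] by (rule bexE)
  obtain M' where M': "M' \<in> atom_module P0" "flows M M'" using vector_atom_flow[OF add(2)] by (rule bexE)
  obtain R' where R': "R' \<in> atom_module P0" "flows R R'" using add(4) by (rule bexE)
  show ?case
    by (rule bexI, rule flows_add[OF flows_scaleR[OF a'(2) M'(2)] R'(2)])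
       (intro atom_module_add atom_module_scale atom_module_term add a' M' R')
next
  case (cong R V)
  obtain R' where R': "R' \<in> atom_module P0" "flows R R'" using cong(1) by (rule bexE)
  have "flows V R'" by (rule flows_cong[OF R'(2) cong(2)])
  then show ?case using R'(1) by (rule bexI)
qed

lemma normal_form_flow:
  assumes "V \<in> normal_forms P0"
  shows "\<exists>L\<in>normal_forms P0. flows V L"
proof -
  obtain A B R where A: "A \<in> smooth_coeffs" and B: "B \<in> smooth_coeffs" and R: "R \<in> atom_module P0"
    and V: "\<forall>t>0. \<forall>x. V t x = A t *\<^sub>R x + B t *\<^sub>R posterior_mean P0 t x + R t x"
    using assms by (auto simp: normal_forms_def)
  obtain R' where R': "R' \<in> atom_module P0" "flows R R'" using atom_module_flow[OF R] by (rule bexE)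
  note flow = flows_add[OF flows_add[OF flows_scaleR[OF flows_coeff[OF A] flows_identity]
        flows_scaleR[OF flows_coeff[OF B] flows_mean]] R'(2)]
  show ?thesis
  proof (rule bexI, rule flows_cong[OF flow])
    \<comment> \<open>The new coefficients of x and of the posterior mean. The latter gains A
      \<lambda> / 2 from the derivative of x, while B times \<open>mean_flow\<close> goes to the
      module.\<close>
    have "(\<lambda>t. A t * (score_shift t * (1 / 2)) + (- deriv A t)) \<in> smooth_coeffs"
      "(\<lambda>t. A t * (score_gain t * (1 / 2)) + (- deriv B t)) \<in> smooth_coeffs"
      by (intro smooth_coeffs_intros smooth_coeffs_minus_deriv A B)+
    moreover have "(\<lambda>t x. B t *\<^sub>R mean_flow t x + R' t x) \<in> atom_module P0"
      by (intro atom_module_add atom_module_scale[OF scalar_algebra_coeff[OF B]] mean_flow_atom_module R')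
    ultimately show "(\<lambda>t x. A t *\<^sub>R ((score_shift t / 2) *\<^sub>R x + (score_gain t / 2) *\<^sub>R posterior_mean P0 t x)
        + (- deriv A t) *\<^sub>R x + (B t *\<^sub>R mean_flow t x + (- deriv B t) *\<^sub>R posterior_mean P0 t x)
        + R' t x) \<in> normal_forms P0"
      by (rule normal_formsI) (simp add: algebra_simps)
  qed (use V in auto)
qed

text \<open>Existence of both partial derivatives comes from the joint derivative, so the total
  operators in \<open>material_deriv\<close> have their intended values at positive times.\<close>

lemma normal_form_material:
  assumes "V \<in> normal_forms P0"
  shows "material_differentiable V" "material_deriv P0 V \<in> normal_forms P0"
proof -
  obtain L where L: "L \<in> normal_forms P0" "flows V L" using normal_form_flow[OF assms] by (rule bexE)
  note m = transported_material[OF L(2)[unfolded flows_def]]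
  show "material_differentiable V" unfolding material_differentiable_def using m(1,2) by blast
  show "material_deriv P0 V \<in> normal_forms P0" using L(1) m(3) by (auto simp: normal_forms_def)
qed

end

theorem lemma3p7:
  fixes P0 :: "(real ^ 'd) measure"
  assumes "prob_space P0" and "sets P0 = sets borel"
  shows "(\<forall>V\<in>normal_forms P0. material_differentiable V) \<and>
    material_deriv P0 ` normal_forms P0 \<subseteq> normal_forms P0 \<and>
    (\<forall>j\<ge>1. \<exists>A\<in>smooth_coeffs. \<exists>A'\<in>smooth_coeffs. \<exists>R\<in>atom_module P0. \<forall>t>0. \<forall>x.
       (material_deriv P0 ^^ j) (\<lambda>t x. x) t x
         = A t *\<^sub>R x + A' t *\<^sub>R posterior_mean P0 t x + R t x)"
proof -
  interpret prob_space P0 by fact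
  interpret prior P0 by unfold_locales fact
  \<comment> \<open>The induction starts at j = 0, where the identity field is a normal form with
    coefficients 1 and 0 and zero remainder.\<close>
  have "(material_deriv P0 ^^ j) (\<lambda>t x. x) \<in> normal_forms P0" for j
    by (induction j) (simp_all add: identity_normal_form normal_form_material(2))
  then have "\<exists>A\<in>smooth_coeffs. \<exists>A'\<in>smooth_coeffs. \<exists>R\<in>atom_module P0. \<forall>t>0. \<forall>x.
       (material_deriv P0 ^^ j) (\<lambda>t x. x) t x
         = A t *\<^sub>R x + A' t *\<^sub>R posterior_mean P0 t x + R t x" for j
    unfolding normal_forms_def by (rule CollectD)
  then show ?thesis
    by (intro conjI ballI allI impI image_subsetI normal_form_material)
qed

end
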